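(* Let $\vec U=\vec U(t)$ be a differentiable solution, for $t\ge0$ in its interval of existence, of the nonlinear semi-discrete SBP-SAT scheme $$(P\otimes I_M)\vec U_t+\mathbf{D}_{x_i}\mathbf{A}_i\vec U+\mathbf{A}_i^T\mathbf{D}_{x_i}\vec U+\mathbf{C}\vec U+\vec L_D=0,\qquad \vec U(0)=\vec F,$$ with all objects as defined in the context, where $C+C^T=0$ and the discrete lifting operator is $$\vec L_D=(I_n\otimes P_\Omega)^{-1}(I_n\otimes E^T)(P_{erm})^T(P_{\partial\Omega}\otimes I_n)\vec L_C,\qquad \vec L_C=((L_C)_1,\dots,(L_C)_N)^T,$$ $$(L_C)_j=\Big(2(I^-T^{-1})^T\Sigma\big(\sqrt{|\Lambda^-|}\,\vec W^--R\sqrt{\Lambda^+}\,\vec W^+-S\vec G\big)\Big)_j,\qquad j=1,\dots,N.$$ (i) Suppose $\vec G=0$ and that at every boundary node $I-R^TR\ge0$ and $\Sigma=\sqrt{|\Lambda^-|}$. Then the scheme is nonlinearly stable: the solution satisfies $$\|\vec U\|^2_{P\otimes P_\Omega}\le\|\vec F\|^2_{P\otimes P_\Omega}.$$ (ii) Suppose $\vec G\ne0$ and that at every boundary node $I-R^TR>0$, $$I-S^TS-(R^TS)^T(I-R^TR)^{-1}(R^TS)\ge0,$$ and $\Sigma=\sqrt{|\Lambda^-|}$. Then the scheme is strongly nonlinearly stable: the solution satisfies $$\|\vec U\|^2_{P\otimes P_\Omega}\le\|\vec F\|^2_{P\otimes P_\Omega}+2\int_0^t\sum_{j=1}^N\big[\vec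 G^T\vec G\big]_j\,ds_j\,dt .$$
   Context: Repeated indices $i$ are summed over $i=1,\dots,k$ (Einstein convention). The scheme approximates $PU_t+(A_iU)_{x_i}+A_i^TU_{x_i}+CU+L_C=0$ in $\Omega\subset\mathbb{R}^k$, where $U$ has $n$ components, $P$ is a constant symmetric positive definite (or semi-definite) $n\times n$ matrix, and $A_i=A_i(U)$, $C=C(U)$ are $n\times n$ matrices depending smoothly on the state $U$. Grid and operators: there are $M$ nodes in total and $N$ boundary nodes. $\vec U=(\vec U_1^T,\dots,\vec U_n^T)^T\in\mathbb{R}^{nM}$, where $\vec U_l\in\mathbb{R}^M$ contains the approximations of component $l$ of $U$ at the nodes. $\mathbf{A}_i$ and $\mathbf{C}$ are $n\times n$ block matrices whose $(r,s)$ block is the $M\times M$ diagonal matrix holding the values of the entry $(A_i)_{rs}$, respectively $C_{rs}$, evaluated at the discrete solution in the nodes. $I_m$ is the $m\times m$ identity and $\otimes$ the Kronecker product. $\mathbf{D}_{x_i}=I_n\otimes D_{x_i}$ with $D_{x_i}=P_\Omega^{-1}Q_{x_i}$, where $P_\Omega$ is a positive definite diagonal $M\times M$ volume quadrature matrix and the summation-by-parts (SBP) constraint holds: $$Q_{x_i}+Q_{x_i}^T=E^TP_{\partial\Omega}N_iE\quad(\text{for each } i).$$ Here $E$ is the $N\times M$ restriction operator that extracts the boundary node values (each row has a single nonzero entry, equal to 1), $P_{\partial\Omega}=\mathrm{diag}(ds_1,\dots,ds_N)$ with $ds_j>0$ is the boundary quadrature, and $N_i$ is the diagonal $N\times N$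 matrix of the $i$-th components of the discrete outward normal at the boundary nodes. $P_{erm}$ is the permutation matrix that reorders $(E\vec U_1,\dots,E\vec U_n)^T$ (organised by variable) into $((E\vec U)_1,\dots,(E\vec U)_N)^T$ (organised by boundary node), where $(E\vec U)_j\in\mathbb{R}^n$ is the state at boundary node $j$. The norm is $\|\vec U\|^2_{P\otimes P_\Omega}=\vec U^T(P\otimes P_\Omega)\vec U$. The vectors $\vec F$ and $\vec G$ are external initial and boundary data injected in the nodes. Boundary quantities, at each boundary node $j$: $\tilde A$ is the symmetric part of $\sum_i(N_i)_{jj}A_i$ evaluated at $(E\vec U)_j$; $T$ is a non-singular matrix (possibly solution dependent) with $T^T\tilde AT=\Lambda=\mathrm{diag}(\lambda_1,\dots,\lambda_n)$; and $\vec W_j=(T^{-1}(E\vec U))_j$. $W^-\in\mathbb{R}^{m_-}$ collects the components of $W$ with $\lambda_l<0$ and $W^+\in\mathbb{R}^{m_+}$ the remaining ones ($m_-+m_+=n$), and $\Lambda^-$, $\Lambda^+$ are the corresponding diagonal matrices. $I^-$ is the selection matrix with $I^-W=W^-$. $|\cdot|$ and $\sqrt{\cdot}$ of a diagonal matrix are taken entrywise on the diagonal. $R$ is $m_-\times m_+$, $S$ is non-singular $m_-\times m_-$, $\Sigma$ is $m_-\times m_-$, and the data $\vec G_j\in\mathbb{R}^{m_-}$; $R$ and $S$ may depend on the node and on the solution. The notation $[\cdot]_j$ or $(\cdot)_j$ means evaluation at boundary node $j$. For a symmetric matrix $X$, $X\ge0$ means positive semi-definite and $X>0$ positive definite. 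*)

theory Defs
  imports
    "HOL-Analysis.Henstock_Kurzweil_Integration"
    "Jordan_Normal_Form.Gauss_Jordan_Elimination"
begin

(* All vectors and matrices are those of Jordan_Normal_Form: the sizes m_- and m_+ of the boundary
   blocks vary with the node and with the solution, so dimensions cannot be types.  Indices of
   components, nodes and space directions start at 0. *)

unbundle no vec_syntax
unbundle no inner_syntax
hide_const (open) Finite_Cartesian_Product.vec Finite_Cartesian_Product.mat
  Finite_Cartesian_Product.row Finite_Cartesian_Product.transpose
hide_type (open) Finite_Cartesian_Product.vec

notation transpose_mat (\<open>(_\<^sup>T)\<close> [1000] 1000)

(* only meaningful for non-singular square matrices *)
definition minv :: "real mat \<Rightarrow> real mat" where
  "minv X = the (mat_inverse X)"

definition kron :: "real mat \<Rightarrow> real mat \<Rightarrow> real mat" (infixl \<open>\<otimes>\<^sub>K\<close> 75) where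
  "X \<otimes>\<^sub>K Y = mat (dim_row X * dim_row Y) (dim_col X * dim_col Y)
     (\<lambda>(a, b). X $$ (a div dim_row Y, b div dim_col Y) * Y $$ (a mod dim_row Y, b mod dim_col Y))"

definition qform :: "real mat \<Rightarrow> real vec \<Rightarrow> real" where
  "qform X v = v \<bullet> (X *\<^sub>v v)"

definition pos_semidef :: "nat \<Rightarrow> real mat \<Rightarrow> bool" where
  "pos_semidef m X \<longleftrightarrow> X \<in> carrier_mat m m \<and> X\<^sup>T = X \<and> (\<forall>v \<in> carrier_vec m. 0 \<le> qform X v)"

definition pos_def :: "nat \<Rightarrow> real mat \<Rightarrow> bool" where
  "pos_def m X \<longleftrightarrow> X \<in> carrier_mat m m \<and> X\<^sup>T = X \<and>
     (\<forall>v \<in> carrier_vec m. v \<noteq> 0\<^sub>v m \<longrightarrow> 0 < qform X v)"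

definition open_states :: "nat \<Rightarrow> real vec set \<Rightarrow> bool" where
  "open_states n D \<longleftrightarrow> D \<subseteq> carrier_vec n \<and>
     (\<forall>u \<in> D. \<exists>\<delta>>0. \<forall>v \<in> carrier_vec n. (\<forall>l<n. \<bar>v $ l - u $ l\<bar> < \<delta>) \<longrightarrow> v \<in> D)"

(* f is p times continuously differentiable on the open set D of n-component states: all partial
   derivatives of order p, taken successively, exist on D and are continuous there *)
fun Ck_on :: "nat \<Rightarrow> nat \<Rightarrow> real vec set \<Rightarrow> (real vec \<Rightarrow> real) \<Rightarrow> bool" where
  "Ck_on 0 n D f \<longleftrightarrow>
     (\<forall>u \<in> D. \<forall>\<epsilon>>0. \<exists>\<delta>>0. \<forall>v \<in> D. (\<forall>l<n. \<bar>v $ l - u $ l\<bar> < \<delta>) \<longrightarrow> \<bar>f v - f u\<bar> < \<epsilon>)"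
| "Ck_on (Suc p) n D f \<longleftrightarrow>
     (\<forall>l<n. \<exists>g. Ck_on p n D g \<and>
        (\<forall>u \<in> D. ((\<lambda>s. f (u + s \<cdot>\<^sub>v unit_vec n l)) has_real_derivative g u) (at 0)))"

definition smooth_mat_on :: "nat \<Rightarrow> real vec set \<Rightarrow> (real vec \<Rightarrow> real mat) \<Rightarrow> bool" where
  "smooth_mat_on n D B \<longleftrightarrow> (\<forall>u \<in> D. B u \<in> carrier_mat n n) \<and>
     (\<forall>r<n. \<forall>s<n. \<forall>p. Ck_on p n D (\<lambda>u. B u $$ (r, s)))"

(* A grid vector is organised by variable: component l at node p has index l * M + p. *)

definition component :: "nat \<Rightarrow> real vec \<Rightarrow> nat \<Rightarrow> real vec" where
  "component M U l = vec M (\<lambda>p. U $ (l * M + p))"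

definition node_state :: "nat \<Rightarrow> nat \<Rightarrow> real vec \<Rightarrow> nat \<Rightarrow> real vec" where
  "node_state n M U p = vec n (\<lambda>l. component M U l $ p)"

definition bnd_state :: "nat \<Rightarrow> nat \<Rightarrow> real mat \<Rightarrow> real vec \<Rightarrow> nat \<Rightarrow> real vec" where
  "bnd_state n M E U j = vec n (\<lambda>l. (E *\<^sub>v component M U l) $ j)"

(* the n x n block matrix whose (r,s) block is the M x M diagonal matrix of the nodal values of
   the (r,s) entry of B *)
definition nodal_mat :: "nat \<Rightarrow> nat \<Rightarrow> (real vec \<Rightarrow> real mat) \<Rightarrow> real vec \<Rightarrow> real mat" where
  "nodal_mat n M B U = mat (n * M) (n * M) (\<lambda>(a, b).
     if a mod M = b mod M then B (node_state n M U (a mod M)) $$ (a div M, b div M) else 0)"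

(* from index l * N + j (variable l, boundary node j) to index j * n + l *)
definition Perm :: "nat \<Rightarrow> nat \<Rightarrow> real mat" where
  "Perm n N = mat (N * n) (n * N) (\<lambda>(a, b).
     if a div n = b mod N \<and> a mod n = b div N then 1 else 0)"

definition stack :: "nat \<Rightarrow> nat \<Rightarrow> (nat \<Rightarrow> real vec) \<Rightarrow> real vec" where
  "stack n N f = vec (N * n) (\<lambda>a. f (a div n) $ (a mod n))"

(* symmetric part of the sum over i of (N_i)_jj A_i, evaluated in the state u *)
definition Atilde ::
    "nat \<Rightarrow> nat \<Rightarrow> (nat \<Rightarrow> real mat) \<Rightarrow> (nat \<Rightarrow> real vec \<Rightarrow> real mat) \<Rightarrow> nat \<Rightarrow> real vec \<Rightarrow> real mat" where
  "Atilde k n Nrm A j u =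
     (let X = mat n n (\<lambda>(r, s). \<Sum>i<k. Nrm i $$ (j, j) * A i u $$ (r, s))
      in (1 / 2) \<cdot>\<^sub>m (X + X\<^sup>T))"

definition neg_ind :: "nat \<Rightarrow> (nat \<Rightarrow> real) \<Rightarrow> nat list" where
  "neg_ind n lam = filter (\<lambda>l. lam l < 0) [0..<n]"

definition nonneg_ind :: "nat \<Rightarrow> (nat \<Rightarrow> real) \<Rightarrow> nat list" where
  "nonneg_ind n lam = filter (\<lambda>l. \<not> lam l < 0) [0..<n]"

abbreviation m_neg :: "nat \<Rightarrow> (nat \<Rightarrow> real) \<Rightarrow> nat" where
  "m_neg n lam \<equiv> length (neg_ind n lam)"

abbreviation m_nonneg :: "nat \<Rightarrow> (nat \<Rightarrow> real) \<Rightarrow> nat" where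
  "m_nonneg n lam \<equiv> length (nonneg_ind n lam)"

definition select_mat :: "nat \<Rightarrow> nat list \<Rightarrow> real mat" where
  "select_mat n is = mat (length is) n (\<lambda>(a, l). if l = is ! a then 1 else 0)"

definition Lam_neg :: "nat \<Rightarrow> (nat \<Rightarrow> real) \<Rightarrow> real mat" where
  "Lam_neg n lam = mat_diag (m_neg n lam) (\<lambda>a. lam (neg_ind n lam ! a))"

definition Lam_nonneg :: "nat \<Rightarrow> (nat \<Rightarrow> real) \<Rightarrow> real mat" where
  "Lam_nonneg n lam = mat_diag (m_nonneg n lam) (\<lambda>a. lam (nonneg_ind n lam ! a))"

(* applied to diagonal matrices only, whose off-diagonal zeros are preserved *)
definition abs_diag :: "real mat \<Rightarrow> real mat" where
  "abs_diag X = map_mat abs X"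

definition sqrt_diag :: "real mat \<Rightarrow> real mat" where
  "sqrt_diag X = map_mat sqrt X"

(* (L_C)_j, with T, Sigma, R, S, G and the eigenvalues lam already evaluated at the boundary node j,
   whose state is w *)
definition lift_node ::
    "nat \<Rightarrow> (nat \<Rightarrow> real) \<Rightarrow> real mat \<Rightarrow> real mat \<Rightarrow> real mat \<Rightarrow> real mat \<Rightarrow> real vec \<Rightarrow> real vec \<Rightarrow> real vec" where
  "lift_node n lam T Sig R S g w =
     (let I_neg = select_mat n (neg_ind n lam);
          I_nonneg = select_mat n (nonneg_ind n lam);
          W = minv T *\<^sub>v w;
          W_neg = I_neg *\<^sub>v W;
          W_nonneg = I_nonneg *\<^sub>v W
      in (2 \<cdot>\<^sub>m (I_neg * minv T)\<^sup>T * Sig) *\<^sub>v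
           (sqrt_diag (abs_diag (Lam_neg n lam)) *\<^sub>v W_neg
            - R *\<^sub>v (sqrt_diag (Lam_nonneg n lam) *\<^sub>v W_nonneg)
            - S *\<^sub>v g))"

definition lift_op ::
    "nat \<Rightarrow> nat \<Rightarrow> real mat \<Rightarrow> real mat \<Rightarrow> (nat \<Rightarrow> real) \<Rightarrow> (nat \<Rightarrow> real vec) \<Rightarrow> real vec" where
  "lift_op n N POm E ds LC =
     (minv (1\<^sub>m n \<otimes>\<^sub>K POm) * (1\<^sub>m n \<otimes>\<^sub>K E\<^sup>T) * (Perm n N)\<^sup>T * (mat_diag N ds \<otimes>\<^sub>K 1\<^sub>m n))
     *\<^sub>v stack n N LC"

end

theory Submission
  imports Defs "Jordan_Normal_Form.Determinant"
begin

text \<open>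
  The proof is the energy method. Testing the scheme with \<open>(I \<otimes> P\<^sub>\<Omega>) U\<close> gives half the time
  derivative of the energy. The quadrature is diagonal, so it commutes with the nodal coefficient
  matrices; the two halves of the split flux term are then \<open>U \<bullet> Q A U\<close> and \<open>A U \<bullet> Q U\<close>, and
  summation by parts reduces their sum to boundary terms without differentiating \<open>A\<close>
  (\<open>energy_rate_of_flux\<close>). The source term vanishes because \<open>C\<close> is skew, and the lifting operator
  is the adjoint of boundary restriction (\<open>energy_rate_of_lift_op\<close>). Hence the energy
  rate is minus twice a weighted sum over boundary nodes of
  \<open>w \<bullet> A\<^sub>n w + w \<bullet> L\<close>, with \<open>A\<^sub>n\<close> the symmetrised normal matrix (\<open>energy_rate\<close>).

  At one boundary node this is a question about quadratic forms. With scaled incoming and outgoing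
  characteristic variables \<open>a\<close> and \<open>b\<close> the bracket \<open>w \<bullet> A\<^sub>n w + w \<bullet> L\<close> equals
  \<open>|a - R b - S g|\<^sup>2 + |b|\<^sup>2 - |R b + S g|\<^sup>2\<close> (\<open>lift_node_completed_square\<close>). For zero data the last
  two terms are nonnegative when \<open>I - R\<^sup>T R\<close> is; for general data they are bounded below by
  \<open>-|g|\<^sup>2\<close>, because the Schur complement condition makes
  \<open>|b|\<^sup>2 + |g|\<^sup>2 - |R b + S g|\<^sup>2\<close> a nonnegative form in \<open>(b, g)\<close> (\<open>add_square_le_of_Schur\<close>).
  Integrating in time gives both estimates (\<open>growth_bounded_by_integral\<close>).
\<close>

section \<open>Matrices\<close>

lemma scalar_prod_mult_mat_vec:
  fixes X :: "real mat"
  assumes "X \<in> carrier_mat m q" "v \<in> carrier_vec m" "w \<in> carrier_vec q"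
  shows "v \<bullet> (X *\<^sub>v w) = (X\<^sup>T *\<^sub>v v) \<bullet> w"
  by (rule transpose_vec_mult_scalar[symmetric]) (use assms in auto)

lemma scalar_prod_symmetric_mat:
  fixes X :: "real mat"
  assumes "X \<in> carrier_mat m m" "X\<^sup>T = X" "v \<in> carrier_vec m" "w \<in> carrier_vec m"
  shows "v \<bullet> (X *\<^sub>v w) = w \<bullet> (X *\<^sub>v v)"
  using scalar_prod_mult_mat_vec[OF assms(1,3,4)] assms
  by (metis comm_scalar_prod mult_mat_vec_carrier)

lemma scalar_prod_self_nonneg: "0 \<le> (v :: real vec) \<bullet> v"
  by (auto simp: scalar_prod_def intro: sum_nonneg)

lemma mat_diag_mult_vec:
  assumes "(v :: real vec) \<in> carrier_vec m"
  shows "mat_diag m f *\<^sub>v v = vec m (\<lambda>a. f a * v $ a)"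
  using assms
  by (intro eq_vecI) (auto simp: mat_diag_def scalar_prod_def if_distrib if_distribR
    sum.delta cong: if_cong)

lemma smult_mat_mult_vec:
  assumes "X \<in> carrier_mat p m" "v \<in> carrier_vec m"
  shows "(c \<cdot>\<^sub>m X) *\<^sub>v v = c \<cdot>\<^sub>v (X *\<^sub>v (v :: real vec))"
  using assms by (intro eq_vecI) (auto simp: scalar_prod_def sum_distrib_left mult.assoc)

lemma zero_mult_mat_vec:
  assumes "v \<in> carrier_vec m"
  shows "0\<^sub>m p m *\<^sub>v (v :: real vec) = 0\<^sub>v p"
  using assms by (intro eq_vecI) (auto simp: scalar_prod_def)

lemma diagonal_mat_mult_vec:
  assumes "diagonal_mat X" "X \<in> carrier_mat m m" "(v :: real vec) \<in> carrier_vec m" "i < m"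
  shows "(X *\<^sub>v v) $ i = X $$ (i, i) * v $ i"
proof -
  have "(X *\<^sub>v v) $ i = (\<Sum>j<m. X $$ (i, j) * v $ j)"
    using assms by (auto simp: scalar_prod_def lessThan_atLeast0)
  also have "\<dots> = (\<Sum>j<m. if j = i then X $$ (i, i) * v $ i else 0)"
    using assms by (intro sum.cong) (auto simp: diagonal_mat_def)
  finally show ?thesis
    using assms by simp
qed

text \<open>A scalar equals its own transpose, so the skew matrix contributes the negative of itself.\<close>

lemma skew_quadratic_form:
  assumes X: "X \<in> carrier_mat m m" and skew: "X + X\<^sup>T = 0\<^sub>m m m" and v: "v \<in> carrier_vec m"
  shows "v \<bullet> (X *\<^sub>v v) = (0 :: real)"
proof -
  have XT: "X\<^sup>T \<in> carrier_mat m m"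
    using X by simp
  have "v \<bullet> (X *\<^sub>v v) = v \<bullet> (X\<^sup>T *\<^sub>v v)"
    using scalar_prod_mult_mat_vec[OF X v v] comm_scalar_prod[of v m "X\<^sup>T *\<^sub>v v"] XT v by simp
  then have "2 * (v \<bullet> (X *\<^sub>v v)) = v \<bullet> ((X + X\<^sup>T) *\<^sub>v v)"
    using X XT v by (simp add: add_mult_distrib_mat_vec[of _ m m] scalar_prod_add_distrib[of _ m])
  also have "\<dots> = 0"
    using v by (simp add: skew zero_mult_mat_vec)
  finally show ?thesis
    by simp
qed

lemma minv_Units:
  assumes X: "X \<in> carrier_mat m m" and "X \<in> Units (ring_mat TYPE(real) m ())"
  shows "minv X \<in> carrier_mat m m" "X * minv X = 1\<^sub>m m" "minv X * X = 1\<^sub>m m"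
proof -
  obtain B where B: "mat_inverse X = Some B"
    using mat_inverse(1)[OF X, where b = "()"] assms(2) by (cases "mat_inverse X") auto
  show "minv X \<in> carrier_mat m m" "X * minv X = 1\<^sub>m m" "minv X * X = 1\<^sub>m m"
    using mat_inverse(2)[OF X B] B by (auto simp: minv_def)
qed

lemma minv_eq:
  assumes X: "X \<in> carrier_mat m m" and Y: "Y \<in> carrier_mat m m"
    and XY: "X * Y = 1\<^sub>m m" "Y * X = 1\<^sub>m m"
  shows "minv X = Y"
proof -
  have "X \<in> Units (ring_mat TYPE(real) m ())"
    using assms by (auto simp: Units_def ring_mat_def)
  note m = minv_Units[OF X this]
  have "minv X = minv X * (X * Y)"
    unfolding XY using m by simp
  also have "\<dots> = (minv X * X) * Y"
    by (rule assoc_mult_mat[OF m(1) X Y, symmetric])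
  also have "\<dots> = Y"
    using m Y by simp
  finally show ?thesis .
qed

lemma minv_invertible:
  assumes X: "X \<in> carrier_mat m m" and "invertible_mat X"
  shows "minv X \<in> carrier_mat m m" "X * minv X = 1\<^sub>m m" "minv X * X = 1\<^sub>m m"
proof -
  obtain B where B: "X * B = 1\<^sub>m m" "B * X = 1\<^sub>m (dim_row B)"
    using assms unfolding invertible_mat_def inverts_mat_def by auto
  have "dim_col B = m"
    using arg_cong[OF B(1), of dim_col] by simp
  moreover have "dim_row B = m"
    using arg_cong[OF B(2), of dim_col] X by simp
  ultimately have "B \<in> carrier_mat m m"
    by auto
  then have "X \<in> Units (ring_mat TYPE(real) m ())"
    using X B by (auto simp: Units_def ring_mat_def)
  from minv_Units[OF X this]
  show "minv X \<in> carrier_mat m m" "X * minv X = 1\<^sub>m m" "minv X * X = 1\<^sub>m m" .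
qed

text \<open>A kernel vector would make the quadratic form vanish, so the determinant is nonzero.\<close>

lemma minv_pos_def:
  assumes "pos_def m X"
  shows "minv X \<in> carrier_mat m m" "X * minv X = 1\<^sub>m m" "minv X * X = 1\<^sub>m m"
proof -
  have X: "X \<in> carrier_mat m m" and
    pos: "\<And>v. v \<in> carrier_vec m \<Longrightarrow> v \<noteq> 0\<^sub>v m \<Longrightarrow> 0 < v \<bullet> (X *\<^sub>v v)"
    using assms by (auto simp: pos_def_def qform_def)
  have "det X \<noteq> 0"
  proof
    assume "det X = 0"
    then obtain v where "v \<in> carrier_vec m" "v \<noteq> 0\<^sub>v m" "X *\<^sub>v v = 0\<^sub>v m"
      using det_0_iff_vec_prod_zero_field[OF X] by auto
    then show False
      using pos[of v] by simp
  qed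
  from minv_Units[OF X det_non_zero_imp_unit[OF X this]]
  show "minv X \<in> carrier_mat m m" "X * minv X = 1\<^sub>m m" "minv X * X = 1\<^sub>m m" .
qed

section \<open>Kronecker products\<close>

text \<open>All grid indices have the form \<open>l * M + p\<close>; this lemma, \<open>prod_index_less\<close> and
  \<open>prod_index_cases\<close> replace \<open>div\<close> and \<open>mod\<close> by the pair \<open>(l, p)\<close>.\<close>

lemma sum_lessThan_prod:
  fixes f :: "nat \<Rightarrow> 'a::comm_monoid_add"
  shows "(\<Sum>a<n * M. f a) = (\<Sum>l<n. \<Sum>p<M. f (l * M + p))"
proof -
  have "sum f {l * M..<l * M + M} = (\<Sum>p<M. f (l * M + p))" for l
    using sum.shift_bounds_nat_ivl[of f 0 "l * M" M] by (simp add: lessThan_atLeast0 add.commute)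
  then show ?thesis
    using sum.nat_group[of f M n] by simp
qed

lemma prod_index_less:
  assumes "l < n" "p < M"
  shows "l * M + p < n * (M::nat)"
proof -
  have "l * M + p < Suc l * M"
    using assms by simp
  also have "\<dots> \<le> n * M"
    using assms by (intro mult_right_mono) auto
  finally show ?thesis .
qed

lemma prod_index_cases:
  assumes "a < n * (M::nat)"
  obtains l p where "a = l * M + p" "l < n" "p < M"
proof
  show "a = (a div M) * M + a mod M"
    by simp
  show "a div M < n"
    using assms by (simp add: less_mult_imp_div_less)
  show "a mod M < M"
    using assms by (cases "M = 0") auto
qed

lemma kron_carrier [simp]:
  "X \<in> carrier_mat a b \<Longrightarrow> Y \<in> carrier_mat c d \<Longrightarrow> X \<otimes>\<^sub>K Y \<in> carrier_mat (a * c) (b * d)"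
  by (auto simp: kron_def)

lemma kron_index:
  assumes "X \<in> carrier_mat a b" "Y \<in> carrier_mat c d" "r < a" "p < c" "s < b" "q < d"
  shows "(X \<otimes>\<^sub>K Y) $$ (r * c + p, s * d + q) = X $$ (r, s) * Y $$ (p, q)"
  using assms by (auto simp: kron_def prod_index_less)

lemma kron_mult:
  assumes X: "X \<in> carrier_mat a b" and Y: "Y \<in> carrier_mat c d"
    and Z: "Z \<in> carrier_mat b e" and W: "W \<in> carrier_mat d f"
  shows "(X \<otimes>\<^sub>K Y) * (Z \<otimes>\<^sub>K W) = (X * Z) \<otimes>\<^sub>K (Y * W)"
proof (rule eq_matI)
  note XY = kron_carrier[OF X Y] and ZW = kron_carrier[OF Z W]
  note XZ = mult_carrier_mat[OF X Z] and YW = mult_carrier_mat[OF Y W]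
  fix i j
  assume "i < dim_row ((X * Z) \<otimes>\<^sub>K (Y * W))" "j < dim_col ((X * Z) \<otimes>\<^sub>K (Y * W))"
  then have ij: "i < a * c" "j < e * f"
    using kron_carrier[OF XZ YW] by auto
  obtain r p where i: "i = r * c + p" and rp: "r < a" "p < c"
    using ij(1) by (rule prod_index_cases)
  obtain s q where j: "j = s * f + q" and sq: "s < e" "q < f"
    using ij(2) by (rule prod_index_cases)
  have "((X \<otimes>\<^sub>K Y) * (Z \<otimes>\<^sub>K W)) $$ (i, j)
      = (\<Sum>h<b * d. (X \<otimes>\<^sub>K Y) $$ (i, h) * (Z \<otimes>\<^sub>K W) $$ (h, j))"
    using ij XY ZW by (auto simp: scalar_prod_def lessThan_atLeast0 intro!: sum.cong)
  also have "\<dots> = (\<Sum>g<b. \<Sum>h<d. (X $$ (r, g) * Z $$ (g, s)) * (Y $$ (p, h) * W $$ (h, q)))"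
    unfolding sum_lessThan_prod i j using rp sq
    by (intro sum.cong refl) (simp add: kron_index[OF X Y] kron_index[OF Z W])
  also have "\<dots> = (\<Sum>g<b. X $$ (r, g) * Z $$ (g, s)) * (\<Sum>h<d. Y $$ (p, h) * W $$ (h, q))"
    by (simp add: sum_product)
  also have "\<dots> = (X * Z) $$ (r, s) * (Y * W) $$ (p, q)"
    using rp sq X Y Z W by (auto simp: scalar_prod_def lessThan_atLeast0)
  also have "\<dots> = ((X * Z) \<otimes>\<^sub>K (Y * W)) $$ (i, j)"
    unfolding i j using kron_index[OF XZ YW] rp sq by simp
  finally show "((X \<otimes>\<^sub>K Y) * (Z \<otimes>\<^sub>K W)) $$ (i, j) = ((X * Z) \<otimes>\<^sub>K (Y * W)) $$ (i, j)" .
qed (use assms in \<open>auto simp: kron_def\<close>)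

lemma kron_transpose: "(X \<otimes>\<^sub>K Y)\<^sup>T = X\<^sup>T \<otimes>\<^sub>K Y\<^sup>T"
  by (rule eq_matI)
    (auto simp: kron_def less_mult_imp_div_less intro!: arg_cong2[where f = "(*)"] index_transpose_mat(1)[symmetric]
      mod_less_divisor gr0I)

lemma kron_one: "1\<^sub>m n \<otimes>\<^sub>K 1\<^sub>m M = 1\<^sub>m (n * M)"
proof (rule eq_matI)
  fix i j
  assume "i < dim_row (1\<^sub>m (n * M))" "j < dim_col (1\<^sub>m (n * M))"
  then have ij: "i < n * M" "j < n * M"
    by auto
  then have "0 < M" "i = j \<longleftrightarrow> i div M = j div M \<and> i mod M = j mod M"
    by (auto intro: gr0I) (metis div_mult_mod_eq)
  with ij show "(1\<^sub>m n \<otimes>\<^sub>K 1\<^sub>m M) $$ (i, j) = 1\<^sub>m (n * M) $$ (i, j)"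
    by (auto simp: kron_def less_mult_imp_div_less)
qed (auto simp: kron_def)

section \<open>Grid vectors\<close>

lemma component_carrier [simp]: "component M V l \<in> carrier_vec M"
  by (simp add: component_def)

lemma node_state_carrier [simp]: "node_state n M V p \<in> carrier_vec n"
  by (simp add: node_state_def)

lemma bnd_state_carrier [simp]: "bnd_state n M E V j \<in> carrier_vec n"
  by (simp add: bnd_state_def)

lemma stack_carrier [simp]: "stack n N f \<in> carrier_vec (N * n)"
  by (simp add: stack_def)

text \<open>Differentiation acts on each component separately and the coefficient matrices act at each
  node separately, so the Euclidean product is needed both as a sum over components and as a sum
  over nodes.\<close>

lemma scalar_prod_component:
  assumes "W \<in> carrier_vec (n * M)"
  shows "V \<bullet> W = (\<Sum>l<n. component M V l \<bullet> component M W l)"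
  using assms
  by (auto simp: scalar_prod_def component_def sum_lessThan_prod simp flip: lessThan_atLeast0)

lemma scalar_prod_node_state:
  assumes "W \<in> carrier_vec (n * M)"
  shows "V \<bullet> W = (\<Sum>p<M. node_state n M V p \<bullet> node_state n M W p)"
  unfolding scalar_prod_component[OF assms]
  by (subst (2) scalar_prod_def, subst scalar_prod_def)
    (auto simp: node_state_def component_def simp flip: lessThan_atLeast0 intro: sum.swap)

lemma scalar_prod_stack:
  assumes "\<And>j. j < N \<Longrightarrow> f j \<in> carrier_vec n" "\<And>j. j < N \<Longrightarrow> g j \<in> carrier_vec n"
  shows "stack n N f \<bullet> stack n N g = (\<Sum>j<N. f j \<bullet> g j)"
proof -
  have "dim_vec (g j) = n" if "j < N" for j
    using assms(2)[OF that] by simp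
  then show ?thesis
    by (simp add: scalar_prod_def stack_def sum_lessThan_prod prod_index_less
      flip: lessThan_atLeast0)
qed

lemma component_kron_one:
  assumes Y: "Y \<in> carrier_mat K M" and V: "V \<in> carrier_vec (n * M)" and l: "l < n"
  shows "component K ((1\<^sub>m n \<otimes>\<^sub>K Y) *\<^sub>v V) l = Y *\<^sub>v component M V l"
proof (rule eq_vecI)
  fix p assume "p < dim_vec (Y *\<^sub>v component M V l)"
  then have p: "p < K"
    using Y by simp
  note kc = kron_carrier[OF one_carrier_mat Y, of n]
  have "component K ((1\<^sub>m n \<otimes>\<^sub>K Y) *\<^sub>v V) l $ p
      = (\<Sum>h<n * M. (1\<^sub>m n \<otimes>\<^sub>K Y) $$ (l * K + p, h) * V $ h)"
    using kc V p l prod_index_less[OF l p]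
    by (auto simp: component_def scalar_prod_def lessThan_atLeast0 intro!: sum.cong)
  also have "\<dots> = (\<Sum>s<n. if s = l then \<Sum>q<M. Y $$ (p, q) * V $ (l * M + q) else 0)"
    unfolding sum_lessThan_prod using p l
    by (intro sum.cong refl) (auto simp: kron_index[OF one_carrier_mat Y])
  also have "\<dots> = (\<Sum>q<M. Y $$ (p, q) * V $ (l * M + q))"
    using l by simp
  also have "\<dots> = (Y *\<^sub>v component M V l) $ p"
    using p Y by (auto simp: component_def scalar_prod_def lessThan_atLeast0)
  finally show "component K ((1\<^sub>m n \<otimes>\<^sub>K Y) *\<^sub>v V) l $ p = (Y *\<^sub>v component M V l) $ p" .
qed (use Y in simp)

lemma nodal_mat_carrier [simp]: "nodal_mat n M B V \<in> carrier_mat (n * M) (n * M)"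
  by (simp add: nodal_mat_def)

text \<open>The blocks of a nodal matrix are diagonal, so it never couples different nodes.\<close>

lemma node_state_nodal_mat:
  assumes B: "B (node_state n M V p) \<in> carrier_mat n n" and W: "W \<in> carrier_vec (n * M)"
    and p: "p < M"
  shows "node_state n M (nodal_mat n M B V *\<^sub>v W) p = B (node_state n M V p) *\<^sub>v node_state n M W p"
proof (rule eq_vecI)
  let ?B = "B (node_state n M V p)"
  fix l assume "l < dim_vec (?B *\<^sub>v node_state n M W p)"
  then have l: "l < n"
    using B by simp
  note lp = prod_index_less[OF l p]
  have "node_state n M (nodal_mat n M B V *\<^sub>v W) p $ l
      = (\<Sum>h<n * M. nodal_mat n M B V $$ (l * M + p, h) * W $ h)"
    using W p l lp carrier_matD[OF nodal_mat_carrier[of n M B V]]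
    by (auto simp: node_state_def component_def scalar_prod_def lessThan_atLeast0 intro!: sum.cong)
  also have "\<dots> = (\<Sum>s<n. \<Sum>q<M. if q = p then ?B $$ (l, s) * W $ (s * M + p) else 0)"
    unfolding sum_lessThan_prod using p l lp
    by (intro sum.cong refl) (auto simp: nodal_mat_def prod_index_less)
  also have "\<dots> = (\<Sum>s<n. ?B $$ (l, s) * W $ (s * M + p))"
    using p by simp
  also have "\<dots> = (?B *\<^sub>v node_state n M W p) $ l"
    using p l B by (auto simp: node_state_def component_def scalar_prod_def lessThan_atLeast0)
  finally show "node_state n M (nodal_mat n M B V *\<^sub>v W) p $ l = (?B *\<^sub>v node_state n M W p) $ l" .
qed (use B in \<open>auto simp: node_state_def\<close>)

section \<open>The boundary terms at one node\<close>

text \<open>Complete the square in \<open>b\<close>. With \<open>X = I - R\<^sup>T R\<close> and \<open>z = X\<^bsup>-1\<^esup> R\<^sup>T S g\<close>, the right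
  side minus the left side is the quadratic form of \<open>X\<close> at \<open>b - z\<close> plus the quadratic form of the
  Schur complement at \<open>g\<close>.\<close>

lemma add_square_le_of_Schur:
  assumes X: "pos_def p (1\<^sub>m p - R\<^sup>T * R)"
    and Y: "pos_semidef m (1\<^sub>m m - S\<^sup>T * S - (R\<^sup>T * S)\<^sup>T * minv (1\<^sub>m p - R\<^sup>T * R) * (R\<^sup>T * S))"
    and R: "R \<in> carrier_mat m p" and S: "S \<in> carrier_mat m m"
    and b: "b \<in> carrier_vec p" and g: "g \<in> carrier_vec m"
  shows "(R *\<^sub>v b + S *\<^sub>v g) \<bullet> (R *\<^sub>v b + S *\<^sub>v g) \<le> b \<bullet> b + g \<bullet> g"
proof -
  define X where "X = 1\<^sub>m p - R\<^sup>T * R"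
  define y where "y = R\<^sup>T *\<^sub>v (S *\<^sub>v g)"
  define z where "z = minv X *\<^sub>v y"
  have RT: "R\<^sup>T \<in> carrier_mat p m" and ST: "S\<^sup>T \<in> carrier_mat m m"
    using R S by auto
  have Xc: "X \<in> carrier_mat p p" and Xsym: "X\<^sup>T = X" and
    Xpos: "\<And>v. v \<in> carrier_vec p \<Longrightarrow> 0 \<le> v \<bullet> (X *\<^sub>v v)"
    using assms(1) unfolding pos_def_def qform_def X_def[symmetric] by (force simp: less_imp_le)+
  note Xi = minv_pos_def[OF assms(1), folded X_def]
  have Rb: "R *\<^sub>v b \<in> carrier_vec m" and Sg: "S *\<^sub>v g \<in> carrier_vec m"
    using R S b g by auto
  have y: "y \<in> carrier_vec p"
    unfolding y_def using RT Sg by auto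
  have z: "z \<in> carrier_vec p"
    unfolding z_def using Xi(1) y by auto
  have Xz: "X *\<^sub>v z = y"
    unfolding z_def by (subst assoc_mult_mat_vec[OF Xc Xi(1) y, symmetric]) (simp add: Xi(2) y)
  have "0 \<le> (b - z) \<bullet> (X *\<^sub>v (b - z))"
    using b z by (intro Xpos) auto
  also have "\<dots> = b \<bullet> (X *\<^sub>v b) - z \<bullet> (X *\<^sub>v b) - b \<bullet> y + z \<bullet> y"
    using b z Xc y
    by (simp add: mult_minus_distrib_mat_vec[of _ p p] Xz minus_scalar_prod_distrib[of _ p]
        scalar_prod_minus_distrib[of _ p])
  also have "z \<bullet> (X *\<^sub>v b) = b \<bullet> y"
    using scalar_prod_symmetric_mat[OF Xc Xsym z b] by (simp add: Xz)
  also have "b \<bullet> (X *\<^sub>v b) = b \<bullet> b - (R *\<^sub>v b) \<bullet> (R *\<^sub>v b)"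
  proof -
    have "X *\<^sub>v b = b - R\<^sup>T *\<^sub>v (R *\<^sub>v b)"
      unfolding X_def using R RT b
      by (simp add: minus_mult_distrib_mat_vec[of _ p p])
    then show ?thesis
      using b R RT Rb scalar_prod_mult_mat_vec[OF RT b Rb]
      by (simp add: scalar_prod_minus_distrib[of _ p])
  qed
  also have "b \<bullet> y = (R *\<^sub>v b) \<bullet> (S *\<^sub>v g)"
    unfolding y_def using scalar_prod_mult_mat_vec[OF RT b Sg] by simp
  finally have 1: "0 \<le> b \<bullet> b - (R *\<^sub>v b) \<bullet> (R *\<^sub>v b) - 2 * ((R *\<^sub>v b) \<bullet> (S *\<^sub>v g)) + z \<bullet> y"
    by simp
  define K where "K = R\<^sup>T * S"
  have K: "K \<in> carrier_mat p m" and KT: "K\<^sup>T \<in> carrier_mat m p"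
    using RT S by (auto simp: K_def)
  have Kg: "K *\<^sub>v g = y"
    unfolding K_def y_def using RT S g by simp
  have "0 \<le> g \<bullet> ((1\<^sub>m m - S\<^sup>T * S - K\<^sup>T * minv X * K) *\<^sub>v g)"
    using Y g unfolding pos_semidef_def qform_def X_def K_def by blast
  also have "(1\<^sub>m m - S\<^sup>T * S - K\<^sup>T * minv X * K) *\<^sub>v g = g - S\<^sup>T *\<^sub>v (S *\<^sub>v g) - K\<^sup>T *\<^sub>v z"
  proof -
    have SS: "S\<^sup>T * S \<in> carrier_mat m m" and KX: "K\<^sup>T * minv X \<in> carrier_mat m p"
      and KXK: "K\<^sup>T * minv X * K \<in> carrier_mat m m"
      using mult_carrier_mat[OF ST S] mult_carrier_mat[OF KT Xi(1)]
        mult_carrier_mat[OF mult_carrier_mat[OF KT Xi(1)] K] by auto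
    have "(1\<^sub>m m - S\<^sup>T * S) *\<^sub>v g = g - S\<^sup>T *\<^sub>v (S *\<^sub>v g)"
      using g by (simp add: minus_mult_distrib_mat_vec[OF one_carrier_mat SS g]
          assoc_mult_mat_vec[OF ST S g])
    moreover have "(K\<^sup>T * minv X * K) *\<^sub>v g = K\<^sup>T *\<^sub>v z"
      unfolding assoc_mult_mat_vec[OF KX K g] Kg z_def by (rule assoc_mult_mat_vec[OF KT Xi(1) y])
    ultimately show ?thesis
      using minus_mult_distrib_mat_vec[OF minus_carrier_mat[OF SS] KXK g] by simp
  qed
  also have "g \<bullet> \<dots> = g \<bullet> g - (S *\<^sub>v g) \<bullet> (S *\<^sub>v g) - y \<bullet> z"
    using g S ST KT z Sg scalar_prod_mult_mat_vec[OF ST g Sg] scalar_prod_mult_mat_vec[OF KT g z]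
    by (simp add: scalar_prod_minus_distrib[of _ m] Kg)
  also have "y \<bullet> z = z \<bullet> y"
    by (rule comm_scalar_prod[OF y z])
  finally have 2: "0 \<le> g \<bullet> g - (S *\<^sub>v g) \<bullet> (S *\<^sub>v g) - z \<bullet> y" .
  have "(R *\<^sub>v b + S *\<^sub>v g) \<bullet> (R *\<^sub>v b + S *\<^sub>v g)
      = (R *\<^sub>v b) \<bullet> (R *\<^sub>v b) + 2 * ((R *\<^sub>v b) \<bullet> (S *\<^sub>v g)) + (S *\<^sub>v g) \<bullet> (S *\<^sub>v g)"
    using Rb Sg comm_scalar_prod[OF Rb Sg]
    by (simp add: add_scalar_prod_distrib[of _ m] scalar_prod_add_distrib[of _ m])
  with 1 2 show ?thesis
    by linarith
qed

lemma square_le_of_contraction: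
  assumes X: "pos_semidef p (1\<^sub>m p - R\<^sup>T * R)"
    and R: "R \<in> carrier_mat m p" and b: "b \<in> carrier_vec p"
  shows "(R *\<^sub>v b) \<bullet> (R *\<^sub>v b) \<le> b \<bullet> b"
proof -
  have RT: "R\<^sup>T \<in> carrier_mat p m" and Rb: "R *\<^sub>v b \<in> carrier_vec m"
    using R b by auto
  have "0 \<le> b \<bullet> ((1\<^sub>m p - R\<^sup>T * R) *\<^sub>v b)"
    using X b unfolding pos_semidef_def qform_def by blast
  also have "\<dots> = b \<bullet> b - (R *\<^sub>v b) \<bullet> (R *\<^sub>v b)"
    using R RT b scalar_prod_mult_mat_vec[OF RT b Rb]
    by (simp add: minus_mult_distrib_mat_vec[of _ p p] scalar_prod_minus_distrib[of _ p])
  finally show ?thesis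
    by simp
qed

lemma sum_nth_filter_upt:
  "(\<Sum>a<length (filter Z [0..<n]). f (filter Z [0..<n] ! a)) = (\<Sum>l | l < n \<and> Z l. f l)"
  for f :: "nat \<Rightarrow> real"
proof -
  have "(\<Sum>a<length (filter Z [0..<n]). f (filter Z [0..<n] ! a)) = sum_list (map f (filter Z [0..<n]))"
    by (simp add: sum_list_sum_nth lessThan_atLeast0)
  also have "\<dots> = sum f (set (filter Z [0..<n]))"
    by (rule sum_list_distinct_conv_sum_set) simp
  also have "set (filter Z [0..<n]) = {l. l < n \<and> Z l}"
    by auto
  finally show ?thesis .
qed

lemma select_mat_mult_vec:
  assumes "set is \<subseteq> {..<n}" "(w :: real vec) \<in> carrier_vec n"
  shows "select_mat n is *\<^sub>v w = vec (length is) (\<lambda>a. w $ (is ! a))"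
proof (rule eq_vecI)
  fix a assume "a < dim_vec (vec (length is) (\<lambda>a. w $ (is ! a)))"
  then have a: "a < length is"
    by simp
  then have "is ! a < n"
    using assms(1) nth_mem by blast
  then show "(select_mat n is *\<^sub>v w) $ a = vec (length is) (\<lambda>a. w $ (is ! a)) $ a"
    using a assms(2)
    by (auto simp: select_mat_def scalar_prod_def if_distrib if_distribR cong: if_cong)
qed (simp add: select_mat_def)

lemma select_mat_carrier [simp]: "select_mat n is \<in> carrier_mat (length is) n"
  by (simp add: select_mat_def)

lemma sqrt_diag_mat_diag: "sqrt_diag (mat_diag m f) = mat_diag m (\<lambda>a. sqrt (f a))"
  by (rule eq_matI) (auto simp: sqrt_diag_def mat_diag_def)

lemma abs_diag_mat_diag: "abs_diag (mat_diag m f) = mat_diag m (\<lambda>a. \<bar>f a\<bar>)"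
  by (rule eq_matI) (auto simp: abs_diag_def mat_diag_def)

lemma sqrt_mult_square:
  assumes "0 \<le> x"
  shows "sqrt x * y * (sqrt x * y) = x * (y * y)"
proof -
  have "sqrt x * y * (sqrt x * y) = (sqrt x * sqrt x) * (y * y)"
    by (simp only: ac_simps)
  then show ?thesis
    using assms by simp
qed

text \<open>In the characteristic variables \<open>W = T\<^bsup>-1\<^esup> w\<close> put \<open>a\<close> for the incoming and \<open>b\<close> for the
  outgoing variables, each scaled by the root of the modulus of its eigenvalue. Congruence by \<open>T\<close>
  turns the flux term into \<open>|b|\<^sup>2 - |a|\<^sup>2\<close>, and with \<open>\<Sigma>\<close> equal to the root of \<open>|\<Lambda>\<^sup>-|\<close> the penalty term
  becomes \<open>2 a \<bullet> (a - R b - S g)\<close>. The penalty thus reverses the sign of \<open>|a|\<^sup>2\<close>, and what remains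
  is a complete square in \<open>a\<close> plus terms free of \<open>a\<close>.\<close>

lemma lift_node_completed_square:
  fixes n :: nat and lam :: "nat \<Rightarrow> real"
  defines "mm \<equiv> m_neg n lam" and "mp \<equiv> m_nonneg n lam"
  assumes T: "T \<in> carrier_mat n n" "invertible_mat T"
    and H: "H \<in> carrier_mat n n" "T\<^sup>T * H * T = mat_diag n lam"
    and R: "R \<in> carrier_mat mm mp" and S: "S \<in> carrier_mat mm mm"
    and Sig: "Sig = sqrt_diag (abs_diag (Lam_neg n lam))"
    and g: "g \<in> carrier_vec mm" and w: "w \<in> carrier_vec n"
  obtains a b where "a \<in> carrier_vec mm" "b \<in> carrier_vec mp"
    "w \<bullet> (H *\<^sub>v w) + w \<bullet> lift_node n lam T Sig R S g w
      = (a - (R *\<^sub>v b + S *\<^sub>v g)) \<bullet> (a - (R *\<^sub>v b + S *\<^sub>v g)) + b \<bullet> b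
        - (R *\<^sub>v b + S *\<^sub>v g) \<bullet> (R *\<^sub>v b + S *\<^sub>v g)"
proof -
  note Ti = minv_invertible[OF T]
  define W where "W = minv T *\<^sub>v w"
  have W: "W \<in> carrier_vec n"
    using Ti(1) w by (auto simp: W_def)
  have TW: "T *\<^sub>v W = w"
    unfolding W_def by (subst assoc_mult_mat_vec[OF T(1) Ti(1) w, symmetric]) (simp add: Ti(2) w)
  define In where "In = select_mat n (neg_ind n lam)"
  define Ip where "Ip = select_mat n (nonneg_ind n lam)"
  \<comment> \<open>scaled incoming and outgoing characteristic variables\<close>
  define a where "a = Sig *\<^sub>v (In *\<^sub>v W)"
  define b where "b = sqrt_diag (Lam_nonneg n lam) *\<^sub>v (Ip *\<^sub>v W)"
  have ind: "set (neg_ind n lam) \<subseteq> {..<n}" "set (nonneg_ind n lam) \<subseteq> {..<n}"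
    by (auto simp: neg_ind_def nonneg_ind_def)
  have In: "In \<in> carrier_mat mm n" and Ip: "Ip \<in> carrier_mat mp n"
    by (simp_all add: In_def Ip_def mm_def mp_def)
  have InW: "In *\<^sub>v W \<in> carrier_vec mm" and IpW: "Ip *\<^sub>v W \<in> carrier_vec mp"
    using In Ip W by auto
  have Sigd: "Sig = mat_diag mm (\<lambda>a. sqrt \<bar>lam (neg_ind n lam ! a)\<bar>)"
    by (simp add: Sig Lam_neg_def sqrt_diag_mat_diag abs_diag_mat_diag mm_def)
  have Sigc: "Sig \<in> carrier_mat mm mm" and SigT: "Sig\<^sup>T = Sig"
    by (auto simp: Sigd mat_diag_def)
  have a_eq: "a = vec mm (\<lambda>i. sqrt \<bar>lam (neg_ind n lam ! i)\<bar> * W $ (neg_ind n lam ! i))"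
    unfolding a_def Sigd mat_diag_mult_vec[OF InW] unfolding In_def
    by (auto simp: select_mat_mult_vec[OF ind(1) W] mm_def)
  have b_eq: "b = vec mp (\<lambda>i. sqrt (lam (nonneg_ind n lam ! i)) * W $ (nonneg_ind n lam ! i))"
    unfolding b_def Lam_nonneg_def sqrt_diag_mat_diag mp_def[symmetric] mat_diag_mult_vec[OF IpW]
    unfolding Ip_def by (auto simp: select_mat_mult_vec[OF ind(2) W] mp_def)
  have a: "a \<in> carrier_vec mm" and b: "b \<in> carrier_vec mp"
    by (simp_all add: a_eq b_eq)
  have "a \<bullet> a = (\<Sum>i<mm. (\<lambda>l. \<bar>lam l\<bar> * (W $ l * W $ l)) (neg_ind n lam ! i))"
    by (simp add: a_eq scalar_prod_def lessThan_atLeast0 sqrt_mult_square)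
  also have "\<dots> = (\<Sum>l | l < n \<and> lam l < 0. \<bar>lam l\<bar> * (W $ l * W $ l))"
    unfolding mm_def neg_ind_def by (rule sum_nth_filter_upt)
  also have "\<dots> = - (\<Sum>l | l < n \<and> lam l < 0. lam l * (W $ l * W $ l))"
    unfolding sum_negf[symmetric] by (intro sum.cong refl) auto
  finally have aa: "a \<bullet> a = - (\<Sum>l | l < n \<and> lam l < 0. lam l * (W $ l * W $ l))" .
  have pos: "i < mp \<Longrightarrow> 0 \<le> lam (nonneg_ind n lam ! i)" for i
    using nth_mem[of i "nonneg_ind n lam"] by (auto simp: mp_def nonneg_ind_def)
  have "b \<bullet> b = (\<Sum>i<mp. (\<lambda>l. lam l * (W $ l * W $ l)) (nonneg_ind n lam ! i))"
    unfolding b_eq scalar_prod_def lessThan_atLeast0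
    by (intro sum.cong) (auto simp: pos sqrt_mult_square)
  also have "\<dots> = (\<Sum>l | l < n \<and> \<not> lam l < 0. lam l * (W $ l * W $ l))"
    unfolding mp_def nonneg_ind_def by (rule sum_nth_filter_upt)
  finally have bb: "b \<bullet> b = (\<Sum>l | l < n \<and> \<not> lam l < 0. lam l * (W $ l * W $ l))" .
  have TT: "T\<^sup>T \<in> carrier_mat n n"
    using T(1) by simp
  \<comment> \<open>the flux term in characteristic variables is diagonal\<close>
  have "w \<bullet> (H *\<^sub>v w) = W \<bullet> (T\<^sup>T *\<^sub>v (H *\<^sub>v (T *\<^sub>v W)))"
    using scalar_prod_mult_mat_vec[OF TT W, of "H *\<^sub>v w"] H(1) w TW by simp
  also have "T\<^sup>T *\<^sub>v (H *\<^sub>v (T *\<^sub>v W)) = mat_diag n lam *\<^sub>v W"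
    unfolding H(2)[symmetric] assoc_mult_mat_vec[OF mult_carrier_mat[OF TT H(1)] T(1) W]
    using T(1) W by (intro assoc_mult_mat_vec[OF TT H(1), symmetric]) auto
  also have "W \<bullet> \<dots> = (\<Sum>l | l < n. lam l * (W $ l * W $ l))"
    using W by (auto simp: mat_diag_mult_vec scalar_prod_def algebra_simps intro!: sum.cong)
  also have "{l. l < n} = {l. l < n \<and> lam l < 0} \<union> {l. l < n \<and> \<not> lam l < 0}"
    by auto
  also have "(\<Sum>l\<in>\<dots>. lam l * (W $ l * W $ l)) = b \<bullet> b - a \<bullet> a"
    unfolding aa bb by (subst sum.union_disjoint) auto
  finally have quad: "w \<bullet> (H *\<^sub>v w) = b \<bullet> b - a \<bullet> a" .
  define q where "q = R *\<^sub>v b + S *\<^sub>v g"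
  have Rb: "R *\<^sub>v b \<in> carrier_vec mm" and Sg: "S *\<^sub>v g \<in> carrier_vec mm"
    using R S b g by auto
  have q: "q \<in> carrier_vec mm"
    using Rb Sg by (simp add: q_def)
  have aq: "a - q = a - R *\<^sub>v b - S *\<^sub>v g"
    using a R S b g by (intro eq_vecI) (auto simp: q_def)
  define K where "K = In * minv T"
  have K: "K \<in> carrier_mat mm n" and KT: "K\<^sup>T \<in> carrier_mat n mm"
    using In Ti(1) by (auto simp: K_def)
  have Kw: "K *\<^sub>v w = In *\<^sub>v W"
    using In Ti(1) w by (simp add: K_def W_def)
  have "lift_node n lam T Sig R S g w = (2 \<cdot>\<^sub>m K\<^sup>T * Sig) *\<^sub>v (a - q)"
    unfolding aq by (simp add: lift_node_def Let_def K_def In_def Ip_def a_def b_def W_def Sig)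
  also have "\<dots> = 2 \<cdot>\<^sub>v (K\<^sup>T *\<^sub>v (Sig *\<^sub>v (a - q)))"
    using KT Sigc a q by (simp add: assoc_mult_mat_vec[of _ n mm _ mm] smult_mat_mult_vec[of _ n mm])
  also have "w \<bullet> \<dots> = 2 * (w \<bullet> (K\<^sup>T *\<^sub>v (Sig *\<^sub>v (a - q))))"
    using w KT by (intro scalar_prod_smult_right) simp
  also have "w \<bullet> (K\<^sup>T *\<^sub>v (Sig *\<^sub>v (a - q))) = (In *\<^sub>v W) \<bullet> (Sig *\<^sub>v (a - q))"
    using scalar_prod_mult_mat_vec[OF KT w, of "Sig *\<^sub>v (a - q)"] Sigc a q Kw by simp
  also have "\<dots> = a \<bullet> (a - q)"
    using scalar_prod_mult_mat_vec[OF Sigc InW, of "a - q"] a q SigT by (simp add: a_def)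
  finally have lift: "w \<bullet> lift_node n lam T Sig R S g w = 2 * (a \<bullet> (a - q))" .
  have "w \<bullet> (H *\<^sub>v w) + w \<bullet> lift_node n lam T Sig R S g w = (a - q) \<bullet> (a - q) + b \<bullet> b - q \<bullet> q"
    unfolding quad lift using a q comm_scalar_prod[OF a q]
    by (simp add: minus_scalar_prod_distrib[of _ mm] scalar_prod_minus_distrib[of _ mm])
  then show ?thesis
    using that[OF a b] by (simp add: q_def)
qed

text \<open>The square in \<open>a\<close> can be dropped, so only the mapping \<open>(b, g) \<mapsto> R b + S g\<close> decides
  whether a boundary node can feed more energy into the scheme than the data provide.\<close>

lemma boundary_dissipation:
  fixes n :: nat and lam :: "nat \<Rightarrow> real"
  defines "mm \<equiv> m_neg n lam" and "mp \<equiv> m_nonneg n lam"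
  assumes T: "T \<in> carrier_mat n n" "invertible_mat T"
    and H: "H \<in> carrier_mat n n" "T\<^sup>T * H * T = mat_diag n lam"
    and R: "R \<in> carrier_mat mm mp" and S: "S \<in> carrier_mat mm mm"
    and Sig: "Sig = sqrt_diag (abs_diag (Lam_neg n lam))"
    and g: "g \<in> carrier_vec mm" and w: "w \<in> carrier_vec n"
    and bound: "\<And>b. b \<in> carrier_vec mp \<Longrightarrow>
      (R *\<^sub>v b + S *\<^sub>v g) \<bullet> (R *\<^sub>v b + S *\<^sub>v g) \<le> b \<bullet> b + g \<bullet> g"
  shows "- (g \<bullet> g) \<le> w \<bullet> (H *\<^sub>v w) + w \<bullet> lift_node n lam T Sig R S g w"
proof -
  obtain a b where ab: "b \<in> carrier_vec mp"
    "w \<bullet> (H *\<^sub>v w) + w \<bullet> lift_node n lam T Sig R S g w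
      = (a - (R *\<^sub>v b + S *\<^sub>v g)) \<bullet> (a - (R *\<^sub>v b + S *\<^sub>v g)) + b \<bullet> b
        - (R *\<^sub>v b + S *\<^sub>v g) \<bullet> (R *\<^sub>v b + S *\<^sub>v g)"
    using lift_node_completed_square[OF T H R[unfolded mm_def mp_def] S[unfolded mm_def] Sig
        g[unfolded mm_def] w] unfolding mp_def by metis
  then show ?thesis
    using bound[OF ab(1)] scalar_prod_self_nonneg[of "a - (R *\<^sub>v b + S *\<^sub>v g)"] by linarith
qed

lemma lift_node_carrier:
  assumes "T \<in> carrier_mat n n" "invertible_mat T"
  shows "lift_node n lam T Sig R S g w \<in> carrier_vec n"
  using minv_invertible(1)[OF assms] by (auto simp: lift_node_def Let_def intro!: carrier_vecI)

section \<open>Energy rate of the scheme\<close>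

text \<open>Adding the two terms replaces \<open>Q\<close> by \<open>Q + Q\<^sup>T\<close>, which factors through the restriction to
  the boundary.\<close>

lemma summation_by_parts:
  fixes Q :: "real mat"
  assumes Q: "Q \<in> carrier_mat M M" and E: "E \<in> carrier_mat N M"
    and Nr: "Nr \<in> carrier_mat N N" "diagonal_mat Nr"
    and SBP: "Q + Q\<^sup>T = E\<^sup>T * mat_diag N ds * Nr * E"
    and a: "a \<in> carrier_vec M" and b: "b \<in> carrier_vec M"
  shows "a \<bullet> (Q *\<^sub>v b) + b \<bullet> (Q *\<^sub>v a) = (\<Sum>j<N. ds j * Nr $$ (j, j) * ((E *\<^sub>v a) $ j * (E *\<^sub>v b) $ j))"
proof -
  have ET: "E\<^sup>T \<in> carrier_mat M N" and QT: "Q\<^sup>T \<in> carrier_mat M M"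
    using E Q by auto
  have Eb: "E *\<^sub>v b \<in> carrier_vec N" and Qtb: "Q\<^sup>T *\<^sub>v b \<in> carrier_vec M"
    using E QT b by auto
  have NEb: "Nr *\<^sub>v (E *\<^sub>v b) \<in> carrier_vec N"
    using Nr Eb by auto
  have dNEb: "mat_diag N ds *\<^sub>v (Nr *\<^sub>v (E *\<^sub>v b)) \<in> carrier_vec N"
    using NEb by (meson mat_diag_dim mult_mat_vec_carrier)
  have "b \<bullet> (Q *\<^sub>v a) = a \<bullet> (Q\<^sup>T *\<^sub>v b)"
    using scalar_prod_mult_mat_vec[OF Q b a] comm_scalar_prod[OF Qtb a] by simp
  then have "a \<bullet> (Q *\<^sub>v b) + b \<bullet> (Q *\<^sub>v a) = a \<bullet> ((Q + Q\<^sup>T) *\<^sub>v b)"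
    using a b Q QT by (simp add: add_mult_distrib_mat_vec[of _ M M] scalar_prod_add_distrib[of _ M])
  also have "(Q + Q\<^sup>T) *\<^sub>v b = E\<^sup>T *\<^sub>v (mat_diag N ds *\<^sub>v (Nr *\<^sub>v (E *\<^sub>v b)))"
    unfolding SBP
      assoc_mult_mat_vec[OF mult_carrier_mat[OF mult_carrier_mat[OF ET mat_diag_dim] Nr(1)] E b]
      assoc_mult_mat_vec[OF mult_carrier_mat[OF ET mat_diag_dim] Nr(1) Eb]
    by (rule assoc_mult_mat_vec[OF ET mat_diag_dim NEb])
  also have "a \<bullet> \<dots> = (E *\<^sub>v a) \<bullet> (mat_diag N ds *\<^sub>v (Nr *\<^sub>v (E *\<^sub>v b)))"
    using scalar_prod_mult_mat_vec[OF ET a dNEb] by simp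
  also have "\<dots> = (\<Sum>j<N. ds j * Nr $$ (j, j) * ((E *\<^sub>v a) $ j * (E *\<^sub>v b) $ j))"
    unfolding mat_diag_mult_vec[OF NEb] scalar_prod_def
    by (auto simp: lessThan_atLeast0 diagonal_mat_mult_vec[OF Nr(2,1) Eb] simp del: index_mult_mat_vec
      intro!: sum.cong)
  finally show ?thesis .
qed

lemma bnd_state_eq_node_state:
  assumes "E \<in> carrier_mat N M" "j < N" "row E j = unit_vec M p" "p < M"
  shows "bnd_state n M E V j = node_state n M V p"
  using assms by (intro eq_vecI) (auto simp: bnd_state_def node_state_def)

lemma scalar_prod_kron_one:
  assumes Y: "Y \<in> carrier_mat M M" and W: "W \<in> carrier_vec (n * M)"
  shows "V \<bullet> ((1\<^sub>m n \<otimes>\<^sub>K Y) *\<^sub>v W) = (\<Sum>l<n. component M V l \<bullet> (Y *\<^sub>v component M W l))"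
proof -
  have "(1\<^sub>m n \<otimes>\<^sub>K Y) *\<^sub>v W \<in> carrier_vec (n * M)"
    using Y W by (meson kron_carrier mult_mat_vec_carrier one_carrier_mat)
  then show ?thesis
    by (simp add: scalar_prod_component component_kron_one[OF Y W])
qed

lemma summation_by_parts_kron:
  assumes Q: "Q \<in> carrier_mat M M" and E: "E \<in> carrier_mat N M"
    and Nr: "Nr \<in> carrier_mat N N" "diagonal_mat Nr"
    and SBP: "Q + Q\<^sup>T = E\<^sup>T * mat_diag N ds * Nr * E"
    and V: "V \<in> carrier_vec (n * M)" and W: "W \<in> carrier_vec (n * M)"
  shows "V \<bullet> ((1\<^sub>m n \<otimes>\<^sub>K Q) *\<^sub>v W) + W \<bullet> ((1\<^sub>m n \<otimes>\<^sub>K Q) *\<^sub>v V)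
    = (\<Sum>j<N. ds j * Nr $$ (j, j) * (bnd_state n M E V j \<bullet> bnd_state n M E W j))"
proof -
  have "V \<bullet> ((1\<^sub>m n \<otimes>\<^sub>K Q) *\<^sub>v W) + W \<bullet> ((1\<^sub>m n \<otimes>\<^sub>K Q) *\<^sub>v V)
      = (\<Sum>l<n. \<Sum>j<N. ds j * Nr $$ (j, j) *
          ((E *\<^sub>v component M V l) $ j * (E *\<^sub>v component M W l) $ j))"
    unfolding scalar_prod_kron_one[OF Q W] scalar_prod_kron_one[OF Q V] sum.distrib[symmetric]
    by (intro sum.cong refl summation_by_parts[OF Q E Nr SBP] component_carrier)
  also have "\<dots> = (\<Sum>j<N. \<Sum>l<n. ds j * Nr $$ (j, j) *
          ((E *\<^sub>v component M V l) $ j * (E *\<^sub>v component M W l) $ j))"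
    by (rule sum.swap)
  also have "\<dots> = (\<Sum>j<N. ds j * Nr $$ (j, j) * (bnd_state n M E V j \<bullet> bnd_state n M E W j))"
    unfolding sum_distrib_left[symmetric]
    by (auto simp: scalar_prod_def bnd_state_def lessThan_atLeast0 simp del: index_mult_mat_vec
      intro!: sum.cong)
  finally show ?thesis .
qed

lemma node_state_kron_one_diagonal:
  assumes Y: "diagonal_mat Y" "Y \<in> carrier_mat M M" and V: "V \<in> carrier_vec (n * M)" and p: "p < M"
  shows "node_state n M ((1\<^sub>m n \<otimes>\<^sub>K Y) *\<^sub>v V) p = Y $$ (p, p) \<cdot>\<^sub>v node_state n M V p"
  using p by (intro eq_vecI)
    (auto simp: node_state_def component_kron_one[OF Y(2) V] diagonal_mat_mult_vec[OF Y]
      simp del: index_mult_mat_vec)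

text \<open>A diagonal quadrature is a scalar at each node, and a scalar commutes with the matrix that a
  nodal matrix places there. This is what allows the quadrature to be moved past
  the transposed coefficient matrix in the non-conservative half of the flux term.\<close>

lemma nodal_mat_kron_one_commute:
  assumes Y: "diagonal_mat Y" "Y \<in> carrier_mat M M" and V: "V \<in> carrier_vec (n * M)"
    and W: "W \<in> carrier_vec (n * M)"
    and B: "\<And>p. p < M \<Longrightarrow> B (node_state n M V p) \<in> carrier_mat n n"
  shows "nodal_mat n M B V *\<^sub>v ((1\<^sub>m n \<otimes>\<^sub>K Y) *\<^sub>v W) = (1\<^sub>m n \<otimes>\<^sub>K Y) *\<^sub>v (nodal_mat n M B V *\<^sub>v W)"
    (is "?L = ?R")
proof (rule eq_vecI)
  note kc = kron_carrier[OF one_carrier_mat Y(2), of n]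
  have YW: "(1\<^sub>m n \<otimes>\<^sub>K Y) *\<^sub>v W \<in> carrier_vec (n * M)"
    and BW: "nodal_mat n M B V *\<^sub>v W \<in> carrier_vec (n * M)"
    using kc W nodal_mat_carrier by (meson mult_mat_vec_carrier)+
  fix a assume "a < dim_vec ?R"
  then have "a < n * M"
    using kc by simp
  then obtain l p where a: "a = l * M + p" and lp: "l < n" "p < M"
    by (rule prod_index_cases)
  have "node_state n M ?L p = node_state n M ?R p"
    using node_state_nodal_mat[of B, OF B[OF lp(2)] YW lp(2)] node_state_nodal_mat[of B, OF B[OF lp(2)] W lp(2)]
      node_state_kron_one_diagonal[OF Y W lp(2)] node_state_kron_one_diagonal[OF Y BW lp(2)]
      mult_mat_vec[OF B[OF lp(2)], of "node_state n M W p"] by simp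
  then have "node_state n M ?L p $ l = node_state n M ?R p $ l"
    by simp
  then show "?L $ a = ?R $ a"
    using lp by (simp add: node_state_def component_def a)
qed (use Y in \<open>simp add: kron_def nodal_mat_def\<close>)

context
  fixes n M :: nat and Y :: "real mat" and V :: "real vec"
  assumes Y: "pos_def M Y" "diagonal_mat Y" and V: "V \<in> carrier_vec (n * M)"
begin

private lemma Yc: "Y \<in> carrier_mat M M" and YT: "Y\<^sup>T = Y"
  using Y(1) by (auto simp: pos_def_def)

private lemma Hc: "1\<^sub>m n \<otimes>\<^sub>K Y \<in> carrier_mat (n * M) (n * M)" and HT: "(1\<^sub>m n \<otimes>\<^sub>K Y)\<^sup>T = 1\<^sub>m n \<otimes>\<^sub>K Y"
  using Yc YT by (simp_all add: kron_transpose)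

private lemma HV: "(1\<^sub>m n \<otimes>\<^sub>K Y) *\<^sub>v V \<in> carrier_vec (n * M)"
  using Hc V by simp

private lemma shift_H:
  assumes "W \<in> carrier_vec (n * M)" "X \<in> carrier_vec (n * M)"
  shows "((1\<^sub>m n \<otimes>\<^sub>K Y) *\<^sub>v W) \<bullet> X = W \<bullet> ((1\<^sub>m n \<otimes>\<^sub>K Y) *\<^sub>v X)"
  using scalar_prod_mult_mat_vec[OF Hc assms] by (simp add: HT)

lemma energy_rate_of_norm_matrix:
  assumes P: "P \<in> carrier_mat n n" and W: "W \<in> carrier_vec (n * M)"
  shows "((1\<^sub>m n \<otimes>\<^sub>K Y) *\<^sub>v V) \<bullet> ((P \<otimes>\<^sub>K 1\<^sub>m M) *\<^sub>v W) = V \<bullet> ((P \<otimes>\<^sub>K Y) *\<^sub>v W)"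
proof -
  note Pc = kron_carrier[OF P one_carrier_mat, of M]
  have "((1\<^sub>m n \<otimes>\<^sub>K Y) *\<^sub>v V) \<bullet> ((P \<otimes>\<^sub>K 1\<^sub>m M) *\<^sub>v W)
      = V \<bullet> ((1\<^sub>m n \<otimes>\<^sub>K Y) *\<^sub>v ((P \<otimes>\<^sub>K 1\<^sub>m M) *\<^sub>v W))"
    using Pc W by (intro shift_H V) simp
  also have "(1\<^sub>m n \<otimes>\<^sub>K Y) *\<^sub>v ((P \<otimes>\<^sub>K 1\<^sub>m M) *\<^sub>v W) = ((1\<^sub>m n \<otimes>\<^sub>K Y) * (P \<otimes>\<^sub>K 1\<^sub>m M)) *\<^sub>v W"
    by (rule assoc_mult_mat_vec[OF Hc Pc W, symmetric])
  also have "(1\<^sub>m n \<otimes>\<^sub>K Y) * (P \<otimes>\<^sub>K 1\<^sub>m M) = P \<otimes>\<^sub>K Y"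
    using P Yc by (simp add: kron_mult[OF one_carrier_mat Yc P one_carrier_mat])
  finally show ?thesis .
qed

text \<open>The skew-symmetric splitting is made for this identity. The quadrature cancels the
  inverse contained in the difference operator, so the conservative half becomes
  \<open>V \<bullet> Q W\<close> with \<open>W = A V\<close>, and the non-conservative half becomes \<open>W \<bullet> Q V\<close>. Their sum sees only the symmetric
  part of \<open>Q\<close>, which is a boundary term: no chain or product rule is used, hence the
  nonlinearity of \<open>A\<close> does no harm.\<close>

lemma energy_rate_of_flux:
  assumes Q: "Q \<in> carrier_mat M M" and E: "E \<in> carrier_mat N M"
    and E_row: "\<And>j. j < N \<Longrightarrow> \<exists>p<M. row E j = unit_vec M p"
    and Nr: "Nr \<in> carrier_mat N N" "diagonal_mat Nr"
    and SBP: "Q + Q\<^sup>T = E\<^sup>T * mat_diag N ds * Nr * E"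
    and B: "\<And>p. p < M \<Longrightarrow> B (node_state n M V p) \<in> carrier_mat n n"
  shows "((1\<^sub>m n \<otimes>\<^sub>K Y) *\<^sub>v V) \<bullet> ((1\<^sub>m n \<otimes>\<^sub>K (minv Y * Q)) *\<^sub>v (nodal_mat n M B V *\<^sub>v V))
      + ((1\<^sub>m n \<otimes>\<^sub>K Y) *\<^sub>v V) \<bullet> ((nodal_mat n M B V)\<^sup>T *\<^sub>v ((1\<^sub>m n \<otimes>\<^sub>K (minv Y * Q)) *\<^sub>v V))
    = (\<Sum>j<N. ds j * Nr $$ (j, j) * (bnd_state n M E V j \<bullet> (B (bnd_state n M E V j) *\<^sub>v bnd_state n M E V j)))"
proof -
  note Yi = minv_pos_def[OF Y(1)]
  have Dc: "1\<^sub>m n \<otimes>\<^sub>K (minv Y * Q) \<in> carrier_mat (n * M) (n * M)"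
    by (intro kron_carrier one_carrier_mat mult_carrier_mat[OF Yi(1) Q])
  have "(1\<^sub>m n \<otimes>\<^sub>K Y) * (1\<^sub>m n \<otimes>\<^sub>K (minv Y * Q)) = 1\<^sub>m n \<otimes>\<^sub>K (Y * (minv Y * Q))"
    using kron_mult[OF one_carrier_mat Yc one_carrier_mat mult_carrier_mat[OF Yi(1) Q], of n] by simp
  also have "Y * (minv Y * Q) = Q"
    using assoc_mult_mat[OF Yc Yi(1) Q] Yi(2) Q by simp
  finally have HD: "(1\<^sub>m n \<otimes>\<^sub>K Y) *\<^sub>v ((1\<^sub>m n \<otimes>\<^sub>K (minv Y * Q)) *\<^sub>v W) = (1\<^sub>m n \<otimes>\<^sub>K Q) *\<^sub>v W"
    if "W \<in> carrier_vec (n * M)" for W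
    using assoc_mult_mat_vec[OF Hc Dc that] by simp
  define W where "W = nodal_mat n M B V *\<^sub>v V"
  have W: "W \<in> carrier_vec (n * M)"
    unfolding W_def using V by (meson nodal_mat_carrier mult_mat_vec_carrier)
  define Z where "Z = (1\<^sub>m n \<otimes>\<^sub>K (minv Y * Q)) *\<^sub>v V"
  have Z: "Z \<in> carrier_vec (n * M)" and DW: "(1\<^sub>m n \<otimes>\<^sub>K (minv Y * Q)) *\<^sub>v W \<in> carrier_vec (n * M)"
    unfolding Z_def using V W Dc by (meson mult_mat_vec_carrier)+
  have 1: "((1\<^sub>m n \<otimes>\<^sub>K Y) *\<^sub>v V) \<bullet> ((1\<^sub>m n \<otimes>\<^sub>K (minv Y * Q)) *\<^sub>v W) = V \<bullet> ((1\<^sub>m n \<otimes>\<^sub>K Q) *\<^sub>v W)"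
    unfolding shift_H[OF V DW] HD[OF W] ..
  have "((1\<^sub>m n \<otimes>\<^sub>K Y) *\<^sub>v V) \<bullet> ((nodal_mat n M B V)\<^sup>T *\<^sub>v Z)
      = (nodal_mat n M B V *\<^sub>v ((1\<^sub>m n \<otimes>\<^sub>K Y) *\<^sub>v V)) \<bullet> Z"
    using scalar_prod_mult_mat_vec[OF _ HV Z, of "(nodal_mat n M B V)\<^sup>T"] by simp
  also have "nodal_mat n M B V *\<^sub>v ((1\<^sub>m n \<otimes>\<^sub>K Y) *\<^sub>v V) = (1\<^sub>m n \<otimes>\<^sub>K Y) *\<^sub>v W"
    unfolding W_def by (rule nodal_mat_kron_one_commute[of Y M V n V B, OF Y(2) Yc V V B])
  also have "\<dots> \<bullet> Z = W \<bullet> ((1\<^sub>m n \<otimes>\<^sub>K Q) *\<^sub>v V)"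
    unfolding shift_H[OF W Z] unfolding Z_def HD[OF V] ..
  finally have 2: "((1\<^sub>m n \<otimes>\<^sub>K Y) *\<^sub>v V) \<bullet> ((nodal_mat n M B V)\<^sup>T *\<^sub>v Z) = W \<bullet> ((1\<^sub>m n \<otimes>\<^sub>K Q) *\<^sub>v V)" .
  \<comment> \<open>each boundary value is the value at a single node, so restriction commutes with \<open>B\<close>\<close>
  have 3: "bnd_state n M E W j = B (bnd_state n M E V j) *\<^sub>v bnd_state n M E V j" if j: "j < N" for j
  proof -
    obtain p where p: "p < M" "row E j = unit_vec M p"
      using E_row[OF j] by auto
    show ?thesis
      unfolding bnd_state_eq_node_state[OF E j p(2,1)] W_def
      by (rule node_state_nodal_mat[of B, OF B[OF p(1)] V p(1)])
  qed
  show ?thesis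
    unfolding W_def[symmetric] Z_def[symmetric] 1 2 summation_by_parts_kron[OF Q E Nr SBP V W]
    by (intro sum.cong refl) (simp add: 3)
qed

lemma energy_rate_of_skew_source:
  assumes B: "\<And>p. p < M \<Longrightarrow> B (node_state n M V p) \<in> carrier_mat n n"
    and skew: "\<And>p. p < M \<Longrightarrow> B (node_state n M V p) + (B (node_state n M V p))\<^sup>T = 0\<^sub>m n n"
  shows "((1\<^sub>m n \<otimes>\<^sub>K Y) *\<^sub>v V) \<bullet> (nodal_mat n M B V *\<^sub>v V) = 0"
proof -
  have BV: "nodal_mat n M B V *\<^sub>v V \<in> carrier_vec (n * M)"
    using V by (meson nodal_mat_carrier mult_mat_vec_carrier)
  have "node_state n M ((1\<^sub>m n \<otimes>\<^sub>K Y) *\<^sub>v V) p \<bullet> node_state n M (nodal_mat n M B V *\<^sub>v V) p = 0"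
    if p: "p < M" for p
  proof -
    have "B (node_state n M V p) *\<^sub>v node_state n M V p \<in> carrier_vec n"
      using B[OF p] by simp
    then show ?thesis
      unfolding node_state_kron_one_diagonal[OF Y(2) Yc V p] node_state_nodal_mat[of B, OF B[OF p] V p]
      using skew_quadratic_form[OF B[OF p] skew[OF p] node_state_carrier[of n M V p]]
      by (simp add: smult_scalar_prod_distrib[OF node_state_carrier])
  qed
  then show ?thesis
    by (simp add: scalar_prod_node_state[OF BV])
qed

text \<open>The lifting operator is built as the adjoint, with respect to the volume and boundary
  quadratures, of restriction to the boundary followed by sorting by boundary node; testing it
  with the weighted \<open>V\<close> therefore gives the boundary quadrature of \<open>L\<close> against the boundary states of \<open>V\<close>.\<close>

lemma energy_rate_of_lift_op:
  assumes E: "E \<in> carrier_mat N M" and L: "\<And>j. j < N \<Longrightarrow> L j \<in> carrier_vec n"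
  shows "((1\<^sub>m n \<otimes>\<^sub>K Y) *\<^sub>v V) \<bullet> lift_op n N Y E ds L = (\<Sum>j<N. ds j * (bnd_state n M E V j \<bullet> L j))"
    and "lift_op n N Y E ds L \<in> carrier_vec (n * M)"
proof -
  note Yi = minv_pos_def[OF Y(1)]
  \<comment> \<open>the inverse quadrature that lifts is the one that the test vector cancels\<close>
  have Hi: "minv (1\<^sub>m n \<otimes>\<^sub>K Y) = 1\<^sub>m n \<otimes>\<^sub>K minv Y"
    using kron_mult[OF one_carrier_mat Yc one_carrier_mat Yi(1), of n]
      kron_mult[OF one_carrier_mat Yi(1) one_carrier_mat Yc, of n]
    by (intro minv_eq[OF Hc]) (simp_all add: Yi kron_one)
  have Hic: "1\<^sub>m n \<otimes>\<^sub>K minv Y \<in> carrier_mat (n * M) (n * M)"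
    by (intro kron_carrier one_carrier_mat Yi)
  have Bc: "1\<^sub>m n \<otimes>\<^sub>K E\<^sup>T \<in> carrier_mat (n * M) (n * N)"
    using E by (intro kron_carrier) auto
  have Pc: "(Perm n N)\<^sup>T \<in> carrier_mat (n * N) (N * n)"
    by (simp add: Perm_def)
  have Dc: "mat_diag N ds \<otimes>\<^sub>K 1\<^sub>m n \<in> carrier_mat (N * n) (N * n)"
    by (intro kron_carrier) auto
  define s where "s = (mat_diag N ds \<otimes>\<^sub>K 1\<^sub>m n) *\<^sub>v stack n N L"
  have s: "s \<in> carrier_vec (N * n)"
    unfolding s_def using Dc by (meson stack_carrier mult_mat_vec_carrier)
  have s_eq: "s = stack n N (\<lambda>j. ds j \<cdot>\<^sub>v L j)"
  proof (rule eq_vecI)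
    fix a assume "a < dim_vec (stack n N (\<lambda>j. ds j \<cdot>\<^sub>v L j))"
    then have "a < N * n"
      by (simp add: stack_def)
    then obtain j l where a: "a = j * n + l" and jl: "j < N" "l < n"
      by (rule prod_index_cases)
    have diag: "mat_diag N ds $$ (j, i) = (if i = j then ds j else 0)" if "i < N" for i
      using jl that by (auto simp: mat_diag_def)
    have dim: "dim_vec (stack n N L) = N * n"
      by (rule carrier_vecD[OF stack_carrier])
    have "s $ a = (\<Sum>h<N * n. (mat_diag N ds \<otimes>\<^sub>K 1\<^sub>m n) $$ (a, h) * stack n N L $ h)"
      unfolding s_def using carrier_matD[OF Dc] \<open>a < N * n\<close>
      by (auto simp: scalar_prod_def lessThan_atLeast0 dim intro!: sum.cong)
    also have "\<dots> = (\<Sum>i<N. \<Sum>m<n. if i = j then if m = l then ds j * L j $ l else 0 else 0)"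
      unfolding sum_lessThan_prod a stack_def using jl prod_index_less[of _ N _ n]
      by (intro sum.cong refl) (auto simp: kron_index[OF mat_diag_dim one_carrier_mat] diag)
    also have "\<dots> = (\<Sum>i<N. if i = j then ds j * L j $ l else 0)"
      using jl by (intro sum.cong refl) auto
    also have "\<dots> = ds j * L j $ l"
      using jl by simp
    also have "\<dots> = stack n N (\<lambda>j. ds j \<cdot>\<^sub>v L j) $ a"
      using jl carrier_vecD[OF L[OF jl(1)]] by (simp add: a stack_def prod_index_less)
    finally show "s $ a = stack n N (\<lambda>j. ds j \<cdot>\<^sub>v L j) $ a" .
  qed (use s in \<open>simp add: stack_def\<close>)
  have Ps: "(Perm n N)\<^sup>T *\<^sub>v s \<in> carrier_vec (n * N)"
    using Pc s by (meson mult_mat_vec_carrier)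
  have BPs: "(1\<^sub>m n \<otimes>\<^sub>K E\<^sup>T) *\<^sub>v ((Perm n N)\<^sup>T *\<^sub>v s) \<in> carrier_vec (n * M)"
    using Bc Ps by (meson mult_mat_vec_carrier)
  have lift: "lift_op n N Y E ds L
      = (1\<^sub>m n \<otimes>\<^sub>K minv Y) *\<^sub>v ((1\<^sub>m n \<otimes>\<^sub>K E\<^sup>T) *\<^sub>v ((Perm n N)\<^sup>T *\<^sub>v s))"
    unfolding lift_op_def Hi
      assoc_mult_mat_vec[OF mult_carrier_mat[OF mult_carrier_mat[OF Hic Bc] Pc] Dc stack_carrier]
    unfolding s_def[symmetric] assoc_mult_mat_vec[OF mult_carrier_mat[OF Hic Bc] Pc s]
    by (rule assoc_mult_mat_vec[OF Hic Bc Ps])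
  show lc: "lift_op n N Y E ds L \<in> carrier_vec (n * M)"
    unfolding lift using Hic BPs by (meson mult_mat_vec_carrier)
  have "(1\<^sub>m n \<otimes>\<^sub>K Y) *\<^sub>v lift_op n N Y E ds L = (1\<^sub>m n \<otimes>\<^sub>K E\<^sup>T) *\<^sub>v ((Perm n N)\<^sup>T *\<^sub>v s)"
    unfolding lift assoc_mult_mat_vec[OF Hc Hic BPs, symmetric]
      kron_mult[OF one_carrier_mat Yc one_carrier_mat Yi(1)] Yi(2)
    using BPs by (simp add: kron_one)
  then have "((1\<^sub>m n \<otimes>\<^sub>K Y) *\<^sub>v V) \<bullet> lift_op n N Y E ds L
      = V \<bullet> ((1\<^sub>m n \<otimes>\<^sub>K E\<^sup>T) *\<^sub>v ((Perm n N)\<^sup>T *\<^sub>v s))"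
    using shift_H[OF V lc] by simp
  also have "\<dots> = ((1\<^sub>m n \<otimes>\<^sub>K E) *\<^sub>v V) \<bullet> ((Perm n N)\<^sup>T *\<^sub>v s)"
    using scalar_prod_mult_mat_vec[OF Bc V Ps] by (simp add: kron_transpose)
  also have "\<dots> = (Perm n N *\<^sub>v ((1\<^sub>m n \<otimes>\<^sub>K E) *\<^sub>v V)) \<bullet> s"
  proof -
    have "(1\<^sub>m n \<otimes>\<^sub>K E) *\<^sub>v V \<in> carrier_vec (n * N)"
      using kron_carrier[OF one_carrier_mat E, of n] V by (meson mult_mat_vec_carrier)
    from scalar_prod_mult_mat_vec[OF Pc this s] show ?thesis
      by simp
  qed
  also have "Perm n N *\<^sub>v ((1\<^sub>m n \<otimes>\<^sub>K E) *\<^sub>v V) = stack n N (bnd_state n M E V)"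
  proof (rule eq_vecI)
    note Ec = kron_carrier[OF one_carrier_mat E, of n]
    fix a assume "a < dim_vec (stack n N (bnd_state n M E V))"
    then have aN: "a < N * n"
      by (simp add: stack_def)
    then obtain j l where a: "a = j * n + l" and jl: "j < N" "l < n"
      by (rule prod_index_cases)
    have "(Perm n N *\<^sub>v ((1\<^sub>m n \<otimes>\<^sub>K E) *\<^sub>v V)) $ a
        = (\<Sum>h<n * N. Perm n N $$ (a, h) * ((1\<^sub>m n \<otimes>\<^sub>K E) *\<^sub>v V) $ h)"
      using aN carrier_matD[OF Ec] by (auto simp: Perm_def scalar_prod_def lessThan_atLeast0 intro!: sum.cong)
    also have "\<dots> = (\<Sum>m<n. \<Sum>i<N. if m = l then if i = j then component N ((1\<^sub>m n \<otimes>\<^sub>K E) *\<^sub>v V) l $ j else 0 else 0)"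
      unfolding sum_lessThan_prod a using jl
      by (intro sum.cong refl)
        (auto simp: Perm_def prod_index_less component_def simp del: index_mult_mat_vec)
    also have "\<dots> = (\<Sum>m<n. if m = l then component N ((1\<^sub>m n \<otimes>\<^sub>K E) *\<^sub>v V) l $ j else 0)"
      using jl by (intro sum.cong refl) auto
    also have "\<dots> = component N ((1\<^sub>m n \<otimes>\<^sub>K E) *\<^sub>v V) l $ j"
      using jl by simp
    also have "\<dots> = stack n N (bnd_state n M E V) $ a"
      using jl component_kron_one[OF E V jl(2)]
      by (simp add: stack_def a prod_index_less bnd_state_def del: index_mult_mat_vec)
    finally show "(Perm n N *\<^sub>v ((1\<^sub>m n \<otimes>\<^sub>K E) *\<^sub>v V)) $ a = stack n N (bnd_state n M E V) $ a" .
  qed (simp add: Perm_def stack_def)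
  also have "stack n N (bnd_state n M E V) \<bullet> s = (\<Sum>j<N. ds j * (bnd_state n M E V j \<bullet> L j))"
    unfolding s_eq using L
    by (subst scalar_prod_stack) (auto simp: scalar_prod_smult_distrib[OF bnd_state_carrier] intro!: sum.cong)
  finally show "((1\<^sub>m n \<otimes>\<^sub>K Y) *\<^sub>v V) \<bullet> lift_op n N Y E ds L
    = (\<Sum>j<N. ds j * (bnd_state n M E V j \<bullet> L j))" .
qed

end

lemma Atilde_carrier [simp]: "Atilde k n Nrm A j u \<in> carrier_mat n n"
  by (auto simp: Atilde_def Let_def)

text \<open>A quadratic form does not see the skew part of its matrix, so symmetrising changes nothing.\<close>

lemma Atilde_quadratic_form:
  assumes A: "\<And>i. i < k \<Longrightarrow> A i u \<in> carrier_mat n n" and v: "v \<in> carrier_vec n"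
  shows "v \<bullet> (Atilde k n Nrm A j u *\<^sub>v v) = (\<Sum>i<k. Nrm i $$ (j, j) * (v \<bullet> (A i u *\<^sub>v v)))"
proof -
  define X where "X = mat n n (\<lambda>(r, s). \<Sum>i<k. Nrm i $$ (j, j) * A i u $$ (r, s))"
  have X: "X \<in> carrier_mat n n" and XT: "X\<^sup>T \<in> carrier_mat n n"
    by (auto simp: X_def)
  have Xv: "X *\<^sub>v v \<in> carrier_vec n" and XTv: "X\<^sup>T *\<^sub>v v \<in> carrier_vec n"
    using X XT v by auto
  have "v \<bullet> (X\<^sup>T *\<^sub>v v) = v \<bullet> (X *\<^sub>v v)"
    using scalar_prod_mult_mat_vec[OF X v v] comm_scalar_prod[OF v XTv] by simp
  then have "v \<bullet> (((1 / 2) \<cdot>\<^sub>m (X + X\<^sup>T)) *\<^sub>v v) = v \<bullet> (X *\<^sub>v v)"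
    using X XT v Xv XTv
    by (simp add: smult_mat_mult_vec[of _ n n] add_mult_distrib_mat_vec[of _ n n]
        scalar_prod_add_distrib[of _ n])
  also have "\<dots> = (\<Sum>r<n. v $ r * (\<Sum>s<n. (\<Sum>i<k. Nrm i $$ (j, j) * A i u $$ (r, s)) * v $ s))"
    using v by (auto simp: X_def scalar_prod_def lessThan_atLeast0 intro!: sum.cong)
  also have "\<dots> = (\<Sum>r<n. \<Sum>i<k. Nrm i $$ (j, j) * (v $ r * (\<Sum>s<n. A i u $$ (r, s) * v $ s)))"
  proof (intro sum.cong refl)
    fix r
    have "(\<Sum>s<n. (\<Sum>i<k. Nrm i $$ (j, j) * A i u $$ (r, s)) * v $ s)
        = (\<Sum>i<k. \<Sum>s<n. Nrm i $$ (j, j) * A i u $$ (r, s) * v $ s)"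
      unfolding sum_distrib_right by (rule sum.swap)
    then show "v $ r * (\<Sum>s<n. (\<Sum>i<k. Nrm i $$ (j, j) * A i u $$ (r, s)) * v $ s)
        = (\<Sum>i<k. Nrm i $$ (j, j) * (v $ r * (\<Sum>s<n. A i u $$ (r, s) * v $ s)))"
      by (simp add: sum_distrib_left mult.assoc mult.left_commute)
  qed
  also have "\<dots> = (\<Sum>i<k. \<Sum>r<n. Nrm i $$ (j, j) * (v $ r * (\<Sum>s<n. A i u $$ (r, s) * v $ s)))"
    by (rule sum.swap)
  also have "\<dots> = (\<Sum>i<k. Nrm i $$ (j, j) * (v \<bullet> (A i u *\<^sub>v v)))"
  proof (intro sum.cong refl)
    fix i assume "i \<in> {..<k}"
    then show "(\<Sum>r<n. Nrm i $$ (j, j) * (v $ r * (\<Sum>s<n. A i u $$ (r, s) * v $ s)))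
        = Nrm i $$ (j, j) * (v \<bullet> (A i u *\<^sub>v v))"
      using carrier_matD[OF A[of i]] carrier_vecD[OF v]
      by (simp add: scalar_prod_def lessThan_atLeast0 sum_distrib_left)
  qed
  finally show ?thesis
    by (simp add: Atilde_def X_def Let_def)
qed

lemma scalar_prod_finsum_vec:
  assumes "finite I" "f \<in> I \<rightarrow> carrier_vec m"
  shows "v \<bullet> finsum_vec TYPE(real) m f I = (\<Sum>i\<in>I. v \<bullet> f i)"
proof -
  have "dim_vec (finsum_vec TYPE(real) m f I) = m"
    using finsum_vec_closed[OF assms(2)] by simp
  moreover have dim: "dim_vec (f i) = m" if "i \<in> I" for i
    by (rule carrier_vecD[OF Pi_mem[OF assms(2) that]])
  ultimately have "v \<bullet> finsum_vec TYPE(real) m f I = (\<Sum>a<m. \<Sum>i\<in>I. v $ a * f i $ a)"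
    by (simp add: scalar_prod_def lessThan_atLeast0 index_finsum_vec[OF assms(1) _ assms(2)]
        sum_distrib_left)
  also have "\<dots> = (\<Sum>i\<in>I. \<Sum>a<m. v $ a * f i $ a)"
    by (rule sum.swap)
  also have "\<dots> = (\<Sum>i\<in>I. v \<bullet> f i)"
    using dim by (intro sum.cong refl) (simp add: scalar_prod_def lessThan_atLeast0)
  finally show ?thesis .
qed

text \<open>The scheme is tested with \<open>(I \<otimes> Y) V\<close>. The flux terms collapse to the boundary, where
  their sum over the directions is the quadratic form of the symmetrised normal matrix; the source
  drops out by skew-symmetry.\<close>

lemma energy_rate:
  assumes Y: "pos_def M Y" "diagonal_mat Y" and V: "V \<in> carrier_vec (n * M)"
    and V': "V' \<in> carrier_vec (n * M)" and P: "P \<in> carrier_mat n n"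
    and A: "\<And>i p. i < k \<Longrightarrow> p < M \<Longrightarrow> A i (node_state n M V p) \<in> carrier_mat n n"
    and C: "\<And>p. p < M \<Longrightarrow> C (node_state n M V p) \<in> carrier_mat n n"
    and C_skew: "\<And>p. p < M \<Longrightarrow> C (node_state n M V p) + (C (node_state n M V p))\<^sup>T = 0\<^sub>m n n"
    and E: "E \<in> carrier_mat N M" and E_row: "\<And>j. j < N \<Longrightarrow> \<exists>p<M. row E j = unit_vec M p"
    and Nrm: "\<And>i. i < k \<Longrightarrow> Nrm i \<in> carrier_mat N N" "\<And>i. i < k \<Longrightarrow> diagonal_mat (Nrm i)"
    and Q: "\<And>i. i < k \<Longrightarrow> Q i \<in> carrier_mat M M"
    and SBP: "\<And>i. i < k \<Longrightarrow> Q i + (Q i)\<^sup>T = E\<^sup>T * mat_diag N ds * Nrm i * E"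
    and L: "\<And>j. j < N \<Longrightarrow> L j \<in> carrier_vec n"
    and scheme: "(P \<otimes>\<^sub>K 1\<^sub>m M) *\<^sub>v V'
         + finsum_vec TYPE(real) (n * M)
             (\<lambda>i. (1\<^sub>m n \<otimes>\<^sub>K (minv Y * Q i)) *\<^sub>v (nodal_mat n M (A i) V *\<^sub>v V)) {..<k}
         + finsum_vec TYPE(real) (n * M)
             (\<lambda>i. (nodal_mat n M (A i) V)\<^sup>T *\<^sub>v ((1\<^sub>m n \<otimes>\<^sub>K (minv Y * Q i)) *\<^sub>v V)) {..<k}
         + nodal_mat n M C V *\<^sub>v V
         + lift_op n N Y E ds L
         = 0\<^sub>v (n * M)"
  shows "V \<bullet> ((P \<otimes>\<^sub>K Y) *\<^sub>v V')
    = - (\<Sum>j<N. ds j * (bnd_state n M E V j \<bullet> (Atilde k n Nrm A j (bnd_state n M E V j) *\<^sub>v bnd_state n M E V j)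
          + bnd_state n M E V j \<bullet> L j))"
proof -
  define w where "w = bnd_state n M E V"
  \<comment> \<open>the test vector: the quadrature-weighted solution\<close>
  define z where "z = (1\<^sub>m n \<otimes>\<^sub>K Y) *\<^sub>v V"
  have Yc: "Y \<in> carrier_mat M M"
    using Y(1) by (simp add: pos_def_def)
  have z: "z \<in> carrier_vec (n * M)"
    unfolding z_def using kron_carrier[OF one_carrier_mat Yc, of n] V by (meson mult_mat_vec_carrier)
  define f where "f i = (1\<^sub>m n \<otimes>\<^sub>K (minv Y * Q i)) *\<^sub>v (nodal_mat n M (A i) V *\<^sub>v V)" for i
  define g where "g i = (nodal_mat n M (A i) V)\<^sup>T *\<^sub>v ((1\<^sub>m n \<otimes>\<^sub>K (minv Y * Q i)) *\<^sub>v V)" for i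
  have Dc: "1\<^sub>m n \<otimes>\<^sub>K (minv Y * Q i) \<in> carrier_mat (n * M) (n * M)" if "i < k" for i
    using minv_pos_def[OF Y(1)] Q[OF that] by (meson kron_carrier mult_carrier_mat one_carrier_mat)
  have NT: "(nodal_mat n M (A i) V)\<^sup>T \<in> carrier_mat (n * M) (n * M)" for i
    by simp
  have f: "f \<in> {..<k} \<rightarrow> carrier_vec (n * M)"
    unfolding f_def
    by (intro Pi_I mult_mat_vec_carrier[OF Dc] mult_mat_vec_carrier[OF nodal_mat_carrier V]) simp
  have g: "g \<in> {..<k} \<rightarrow> carrier_vec (n * M)"
    unfolding g_def by (intro Pi_I mult_mat_vec_carrier[OF NT] mult_mat_vec_carrier[OF Dc V]) simp
  have PV: "(P \<otimes>\<^sub>K 1\<^sub>m M) *\<^sub>v V' \<in> carrier_vec (n * M)"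
    using kron_carrier[OF P one_carrier_mat, of M] V' by (meson mult_mat_vec_carrier)
  have CV: "nodal_mat n M C V *\<^sub>v V \<in> carrier_vec (n * M)"
    using V by (meson mult_mat_vec_carrier nodal_mat_carrier)
  note lift = energy_rate_of_lift_op[where L = L and ds = ds, OF Y V E L]
  note fc = finsum_vec_closed[OF f] and gc = finsum_vec_closed[OF g]
  have "0 = z \<bullet> ((P \<otimes>\<^sub>K 1\<^sub>m M) *\<^sub>v V' + finsum_vec TYPE(real) (n * M) f {..<k}
      + finsum_vec TYPE(real) (n * M) g {..<k} + nodal_mat n M C V *\<^sub>v V + lift_op n N Y E ds L)"
    using scheme z unfolding f_def g_def by simp
  also have "\<dots> = z \<bullet> ((P \<otimes>\<^sub>K 1\<^sub>m M) *\<^sub>v V') + (\<Sum>i<k. z \<bullet> f i) + (\<Sum>i<k. z \<bullet> g i)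
      + z \<bullet> (nodal_mat n M C V *\<^sub>v V) + z \<bullet> lift_op n N Y E ds L"
    using z PV fc gc CV lift(2)
    by (simp add: scalar_prod_add_distrib[of _ "n * M"] scalar_prod_finsum_vec[OF _ f]
        scalar_prod_finsum_vec[OF _ g] del: assoc_add_vec)
  also have "z \<bullet> (nodal_mat n M C V *\<^sub>v V) = 0"
    unfolding z_def by (rule energy_rate_of_skew_source[of M Y V n C, OF Y V C C_skew])
  also have "z \<bullet> lift_op n N Y E ds L = (\<Sum>j<N. ds j * (w j \<bullet> L j))"
    unfolding z_def w_def by (rule lift(1))
  also have "z \<bullet> ((P \<otimes>\<^sub>K 1\<^sub>m M) *\<^sub>v V') = V \<bullet> ((P \<otimes>\<^sub>K Y) *\<^sub>v V')"
    unfolding z_def by (rule energy_rate_of_norm_matrix[OF Y V P V'])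
  finally have "V \<bullet> ((P \<otimes>\<^sub>K Y) *\<^sub>v V')
      = - ((\<Sum>i<k. z \<bullet> f i + z \<bullet> g i) + (\<Sum>j<N. ds j * (w j \<bullet> L j)))"
    by (simp add: sum.distrib)
  also have "(\<Sum>i<k. z \<bullet> f i + z \<bullet> g i)
      = (\<Sum>i<k. \<Sum>j<N. ds j * Nrm i $$ (j, j) * (w j \<bullet> (A i (w j) *\<^sub>v w j)))"
    unfolding z_def w_def f_def g_def
    by (intro sum.cong refl energy_rate_of_flux[of M Y V n, OF Y V _ E E_row] Q Nrm SBP A) auto
  also have "\<dots> = (\<Sum>j<N. \<Sum>i<k. ds j * Nrm i $$ (j, j) * (w j \<bullet> (A i (w j) *\<^sub>v w j)))"
    by (rule sum.swap)
  also have "\<dots> = (\<Sum>j<N. ds j * (w j \<bullet> (Atilde k n Nrm A j (w j) *\<^sub>v w j)))"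
  proof (intro sum.cong refl)
    fix j assume "j \<in> {..<N}"
    \<comment> \<open>boundary states are states at nodes, where the coefficients have the right size\<close>
    then obtain p where "p < M" "w j = node_state n M V p"
      unfolding w_def using E_row bnd_state_eq_node_state[OF E, of j] by blast
    then have "A i (w j) \<in> carrier_mat n n" if "i < k" for i
      using A that by simp
    then have "w j \<bullet> (Atilde k n Nrm A j (w j) *\<^sub>v w j)
        = (\<Sum>i<k. Nrm i $$ (j, j) * (w j \<bullet> (A i (w j) *\<^sub>v w j)))"
      by (rule Atilde_quadratic_form) (simp_all add: w_def)
    then show "(\<Sum>i<k. ds j * Nrm i $$ (j, j) * (w j \<bullet> (A i (w j) *\<^sub>v w j)))
        = ds j * (w j \<bullet> (Atilde k n Nrm A j (w j) *\<^sub>v w j))"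
      by (simp add: sum_distrib_left mult.assoc)
  qed
  finally show ?thesis
    by (simp add: w_def sum.distrib algebra_simps)
qed

section \<open>From the energy rate to the energy estimate\<close>

lemma qform_has_derivative:
  assumes K: "K \<in> carrier_mat m m" "K\<^sup>T = K" and t: "t \<in> J"
    and U: "\<And>s. s \<in> J \<Longrightarrow> U s \<in> carrier_vec m" and v: "v \<in> carrier_vec m"
    and der: "\<And>a. a < m \<Longrightarrow> ((\<lambda>s. U s $ a) has_real_derivative v $ a) (at t within J)"
  shows "((\<lambda>s. qform K (U s)) has_real_derivative 2 * (U t \<bullet> (K *\<^sub>v v))) (at t within J)"
proof -
  have eq: "x \<bullet> (K *\<^sub>v y) = (\<Sum>a<m. \<Sum>b<m. x $ a * (K $$ (a, b) * y $ b))"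
    if "x \<in> carrier_vec m" "y \<in> carrier_vec m" for x y
    using that K(1) by (auto simp: scalar_prod_def sum_distrib_left lessThan_atLeast0 intro!: sum.cong)
  have "((\<lambda>s. \<Sum>a<m. \<Sum>b<m. U s $ a * (K $$ (a, b) * U s $ b)) has_real_derivative
      (\<Sum>a<m. \<Sum>b<m. v $ a * (K $$ (a, b) * U t $ b) + U t $ a * (K $$ (a, b) * v $ b))) (at t within J)"
    by (intro DERIV_sum) (auto intro!: derivative_eq_intros der)
  also have "(\<Sum>a<m. \<Sum>b<m. v $ a * (K $$ (a, b) * U t $ b) + U t $ a * (K $$ (a, b) * v $ b))
      = v \<bullet> (K *\<^sub>v U t) + U t \<bullet> (K *\<^sub>v v)"
    by (simp add: eq U t v sum.distrib)
  also have "\<dots> = 2 * (U t \<bullet> (K *\<^sub>v v))"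
    using scalar_prod_symmetric_mat[OF K v U[OF t]] by simp
  finally show ?thesis
    by (rule has_field_derivative_transform_within[where d = 1]) (use t U in \<open>auto simp: qform_def eq\<close>)
qed

text \<open>The gauge integral recovers a function from its derivative without any assumption on the
  derivative, so the energy rate need not be continuous and the solution only has to be
  differentiable.\<close>

lemma growth_bounded_by_integral:
  fixes e :: "real \<Rightarrow> real"
  assumes J: "is_interval J" "0 \<in> J" and t: "t \<in> J" "0 \<le> t"
    and der: "\<And>s. s \<in> J \<Longrightarrow> (e has_real_derivative e' s) (at s within J)"
    and bound: "\<And>s. s \<in> J \<Longrightarrow> e' s \<le> q s"
    and q: "q integrable_on {0..t}"
  shows "e t \<le> e 0 + integral {0..t} q"
proof -
  have sub: "{0..t} \<subseteq> J"
    using J t unfolding is_interval_1 by (meson atLeastAtMost_iff subsetI)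
  have "(e' has_integral (e t - e 0)) {0..t}"
  proof (rule fundamental_theorem_of_calculus[OF t(2)])
    fix s assume "s \<in> {0..t}"
    then have "(e has_vector_derivative e' s) (at s within J)"
      using der sub by (auto simp flip: has_real_derivative_iff_has_vector_derivative)
    then show "(e has_vector_derivative e' s) (at s within {0..t})"
      by (rule has_vector_derivative_within_subset[OF _ sub])
  qed
  from has_integral_le[OF this integrable_integral[OF q]] bound sub show ?thesis
    by force
qed

section \<open>Stability of the scheme\<close>

theorem proposition5p1:
  fixes k n M N :: nat
    and P POm E :: "real mat"
    and Q Nrm :: "nat \<Rightarrow> real mat"
    and ds :: "nat \<Rightarrow> real"
    and D :: "real vec set"
    and A :: "nat \<Rightarrow> real vec \<Rightarrow> real mat"
    and C :: "real vec \<Rightarrow> real mat"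
    and lam :: "nat \<Rightarrow> real vec \<Rightarrow> nat \<Rightarrow> real"
    and T R S Sig :: "nat \<Rightarrow> real vec \<Rightarrow> real mat"
    and G :: "real \<Rightarrow> nat \<Rightarrow> real vec"
    and F :: "real vec"
    and J :: "real set"
    and U U' :: "real \<Rightarrow> real vec"
  assumes P: "pos_semidef n P"
    and D: "open_states n D"
    and A: "\<And>i. i < k \<Longrightarrow> smooth_mat_on n D (A i)"
    and C: "smooth_mat_on n D C"
    and C_skew: "\<And>u. u \<in> D \<Longrightarrow> C u + (C u)\<^sup>T = 0\<^sub>m n n"
    and POm: "pos_def M POm" "diagonal_mat POm"
    and E: "E \<in> carrier_mat N M" "\<And>j. j < N \<Longrightarrow> \<exists>p<M. row E j = unit_vec M p"
    and ds: "\<And>j. j < N \<Longrightarrow> 0 < ds j"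
    and Nrm: "\<And>i. i < k \<Longrightarrow> Nrm i \<in> carrier_mat N N" "\<And>i. i < k \<Longrightarrow> diagonal_mat (Nrm i)"
    and Q: "\<And>i. i < k \<Longrightarrow> Q i \<in> carrier_mat M M"
    and SBP: "\<And>i. i < k \<Longrightarrow> Q i + (Q i)\<^sup>T = E\<^sup>T * mat_diag N ds * Nrm i * E"
    and J: "is_interval J" "0 \<in> J" "J \<subseteq> {0..}"
    and U: "\<And>t. t \<in> J \<Longrightarrow> U t \<in> carrier_vec (n * M)"
      "\<And>t p. t \<in> J \<Longrightarrow> p < M \<Longrightarrow> node_state n M (U t) p \<in> D"
    and U': "\<And>t. t \<in> J \<Longrightarrow> U' t \<in> carrier_vec (n * M)"
      "\<And>t a. t \<in> J \<Longrightarrow> a < n * M \<Longrightarrow>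
         ((\<lambda>s. U s $ a) has_real_derivative U' t $ a) (at t within J)"
    and T: "\<And>t j. t \<in> J \<Longrightarrow> j < N \<Longrightarrow> T j (U t) \<in> carrier_mat n n"
      "\<And>t j. t \<in> J \<Longrightarrow> j < N \<Longrightarrow> invertible_mat (T j (U t))"
      "\<And>t j. t \<in> J \<Longrightarrow> j < N \<Longrightarrow>
         (T j (U t))\<^sup>T * Atilde k n Nrm A j (bnd_state n M E (U t) j) * T j (U t)
           = mat_diag n (lam j (U t))"
    and R: "\<And>t j. t \<in> J \<Longrightarrow> j < N \<Longrightarrow>
         R j (U t) \<in> carrier_mat (m_neg n (lam j (U t))) (m_nonneg n (lam j (U t)))"
    and S: "\<And>t j. t \<in> J \<Longrightarrow> j < N \<Longrightarrow>
         S j (U t) \<in> carrier_mat (m_neg n (lam j (U t))) (m_neg n (lam j (U t)))"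
      "\<And>t j. t \<in> J \<Longrightarrow> j < N \<Longrightarrow> invertible_mat (S j (U t))"
    and Sig: "\<And>t j. t \<in> J \<Longrightarrow> j < N \<Longrightarrow>
         Sig j (U t) \<in> carrier_mat (m_neg n (lam j (U t))) (m_neg n (lam j (U t)))"
    and G: "\<And>t j. t \<in> J \<Longrightarrow> j < N \<Longrightarrow> G t j \<in> carrier_vec (m_neg n (lam j (U t)))"
    and scheme: "\<And>t. t \<in> J \<Longrightarrow>
         (P \<otimes>\<^sub>K 1\<^sub>m M) *\<^sub>v U' t
         + finsum_vec TYPE(real) (n * M)
             (\<lambda>i. (1\<^sub>m n \<otimes>\<^sub>K (minv POm * Q i)) *\<^sub>v (nodal_mat n M (A i) (U t) *\<^sub>v U t)) {..<k}
         + finsum_vec TYPE(real) (n * M)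
             (\<lambda>i. (nodal_mat n M (A i) (U t))\<^sup>T *\<^sub>v ((1\<^sub>m n \<otimes>\<^sub>K (minv POm * Q i)) *\<^sub>v U t)) {..<k}
         + nodal_mat n M C (U t) *\<^sub>v U t
         + lift_op n N POm E ds
             (\<lambda>j. lift_node n (lam j (U t)) (T j (U t)) (Sig j (U t)) (R j (U t)) (S j (U t))
                    (G t j) (bnd_state n M E (U t) j))
         = 0\<^sub>v (n * M)"
    and init: "U 0 = F"
  shows
    "((\<forall>t\<in>J. \<forall>j<N. G t j = 0\<^sub>v (m_neg n (lam j (U t)))) \<and>
      (\<forall>t\<in>J. \<forall>j<N.
         pos_semidef (m_nonneg n (lam j (U t)))
           (1\<^sub>m (m_nonneg n (lam j (U t))) - (R j (U t))\<^sup>T * R j (U t)) \<and>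
         Sig j (U t) = sqrt_diag (abs_diag (Lam_neg n (lam j (U t)))))
      \<longrightarrow> (\<forall>t\<in>J. qform (P \<otimes>\<^sub>K POm) (U t) \<le> qform (P \<otimes>\<^sub>K POm) F))
     \<and>
     ((\<exists>t\<in>J. \<exists>j<N. G t j \<noteq> 0\<^sub>v (m_neg n (lam j (U t)))) \<and>
      (\<forall>t\<in>J. (\<lambda>s. \<Sum>j<N. (G s j \<bullet> G s j) * ds j) integrable_on {0..t}) \<and>
      (\<forall>t\<in>J. \<forall>j<N.
         pos_def (m_nonneg n (lam j (U t)))
           (1\<^sub>m (m_nonneg n (lam j (U t))) - (R j (U t))\<^sup>T * R j (U t)) \<and>
         pos_semidef (m_neg n (lam j (U t)))
           (1\<^sub>m (m_neg n (lam j (U t))) - (S j (U t))\<^sup>T * S j (U t)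
             - ((R j (U t))\<^sup>T * S j (U t))\<^sup>T
               * minv (1\<^sub>m (m_nonneg n (lam j (U t))) - (R j (U t))\<^sup>T * R j (U t))
               * ((R j (U t))\<^sup>T * S j (U t))) \<and>
         Sig j (U t) = sqrt_diag (abs_diag (Lam_neg n (lam j (U t)))))
      \<longrightarrow> (\<forall>t\<in>J. qform (P \<otimes>\<^sub>K POm) (U t)
             \<le> qform (P \<otimes>\<^sub>K POm) F
               + 2 * integral {0..t} (\<lambda>s. \<Sum>j<N. (G s j \<bullet> G s j) * ds j)))"
proof -
  have Pc: "P \<in> carrier_mat n n" and PT: "P\<^sup>T = P"
    using P by (auto simp: pos_semidef_def)
  have Kc: "P \<otimes>\<^sub>K POm \<in> carrier_mat (n * M) (n * M)" and KT: "(P \<otimes>\<^sub>K POm)\<^sup>T = P \<otimes>\<^sub>K POm"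
    using Pc PT POm(1) by (simp_all add: kron_transpose pos_def_def)
  let ?L = "\<lambda>t j. lift_node n (lam j (U t)) (T j (U t)) (Sig j (U t)) (R j (U t)) (S j (U t))
    (G t j) (bnd_state n M E (U t) j)"
  let ?w = "\<lambda>t. bnd_state n M E (U t)"
  let ?B = "\<lambda>t j. Atilde k n Nrm A j (?w t j)"
  let ?e = "\<lambda>t. qform (P \<otimes>\<^sub>K POm) (U t)"
  let ?e' = "\<lambda>t. 2 * (U t \<bullet> ((P \<otimes>\<^sub>K POm) *\<^sub>v U' t))"
  have der: "(?e has_real_derivative ?e' t) (at t within J)" if "t \<in> J" for t
    using qform_has_derivative[OF Kc KT that U(1) U'(1)[OF that] U'(2)[OF that]] by simp
  have rate: "U t \<bullet> ((P \<otimes>\<^sub>K POm) *\<^sub>v U' t)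
      = - (\<Sum>j<N. ds j * (?w t j \<bullet> (?B t j *\<^sub>v ?w t j) + ?w t j \<bullet> ?L t j))" if t: "t \<in> J" for t
  proof (rule energy_rate[OF POm U(1)[OF t] U'(1)[OF t] Pc _ _ _ E(1) _ Nrm Q SBP _ scheme[OF t]])
    show "A i (node_state n M (U t) p) \<in> carrier_mat n n" if "i < k" "p < M" for i p
      using A[OF that(1)] U(2)[OF t that(2)] by (simp add: smooth_mat_on_def)
    show "C (node_state n M (U t) p) \<in> carrier_mat n n" if "p < M" for p
      using C U(2)[OF t that] by (simp add: smooth_mat_on_def)
    show "C (node_state n M (U t) p) + (C (node_state n M (U t) p))\<^sup>T = 0\<^sub>m n n" if "p < M" for p
      by (rule C_skew[OF U(2)[OF t that]])
    show "\<exists>p<M. row E j = unit_vec M p" if "j < N" for j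
      by (rule E(2)[OF that])
    show "?L t j \<in> carrier_vec n" if "j < N" for j
      by (rule lift_node_carrier[OF T(1)[OF t that] T(2)[OF t that]])
  qed
  have bound: "?e' t \<le> 2 * (\<Sum>j<N. (G t j \<bullet> G t j) * ds j)"
    if t: "t \<in> J"
      and Sig: "\<And>j. j < N \<Longrightarrow> Sig j (U t) = sqrt_diag (abs_diag (Lam_neg n (lam j (U t))))"
      and le: "\<And>j b. j < N \<Longrightarrow> b \<in> carrier_vec (m_nonneg n (lam j (U t))) \<Longrightarrow>
        (R j (U t) *\<^sub>v b + S j (U t) *\<^sub>v G t j) \<bullet> (R j (U t) *\<^sub>v b + S j (U t) *\<^sub>v G t j)
          \<le> b \<bullet> b + G t j \<bullet> G t j" for t
  proof -
    have "- ((G t j \<bullet> G t j) * ds j) \<le> ds j * (?w t j \<bullet> (?B t j *\<^sub>v ?w t j) + ?w t j \<bullet> ?L t j)"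
      if j: "j < N" for j
    proof -
      have "- (G t j \<bullet> G t j) \<le> ?w t j \<bullet> (?B t j *\<^sub>v ?w t j) + ?w t j \<bullet> ?L t j"
        using le[OF j]
        by (intro boundary_dissipation T R S G t j Sig Atilde_carrier bnd_state_carrier)
      from mult_left_mono[OF this, of "ds j"] ds[OF j] show ?thesis
        by (simp add: mult.commute)
    qed
    then have "(\<Sum>j<N. - ((G t j \<bullet> G t j) * ds j))
        \<le> (\<Sum>j<N. ds j * (?w t j \<bullet> (?B t j *\<^sub>v ?w t j) + ?w t j \<bullet> ?L t j))"
      by (intro sum_mono) simp
    then show ?thesis
      unfolding rate[OF t] by (simp add: sum_negf)
  qed
  have estimate: "?e t \<le> qform (P \<otimes>\<^sub>K POm) F + integral {0..t} q"
    if "t \<in> J" "q integrable_on {0..t}" "\<And>s. s \<in> J \<Longrightarrow> ?e' s \<le> q s" for t q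
  proof -
    have "0 \<le> t"
      using that(1) J(3) by auto
    from growth_bounded_by_integral[OF J(1,2) that(1) this der that(3,2)] show ?thesis
      by (simp add: init)
  qed
  show ?thesis
  proof (intro conjI impI ballI; elim conjE)
    fix t
    assume t: "t \<in> J" and G0: "\<forall>t\<in>J. \<forall>j<N. G t j = 0\<^sub>v (m_neg n (lam j (U t)))"
      and h: "\<forall>t\<in>J. \<forall>j<N. pos_semidef (m_nonneg n (lam j (U t)))
           (1\<^sub>m (m_nonneg n (lam j (U t))) - (R j (U t))\<^sup>T * R j (U t)) \<and>
         Sig j (U t) = sqrt_diag (abs_diag (Lam_neg n (lam j (U t))))"
    have "?e' s \<le> 0" if s: "s \<in> J" for s
    proof -
      have "?e' s \<le> 2 * (\<Sum>j<N. (G s j \<bullet> G s j) * ds j)"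
      proof (rule bound[OF s])
        fix j and b :: "real vec"
        assume j: "j < N" and b: "b \<in> carrier_vec (m_nonneg n (lam j (U s)))"
        have "S j (U s) *\<^sub>v G s j = 0\<^sub>v (m_neg n (lam j (U s)))"
          using G0 s j S(1)[OF s j] by (intro eq_vecI) auto
        moreover have "R j (U s) *\<^sub>v b \<in> carrier_vec (m_neg n (lam j (U s)))"
          using R[OF s j] b by simp
        moreover have "(R j (U s) *\<^sub>v b) \<bullet> (R j (U s) *\<^sub>v b) \<le> b \<bullet> b"
          using h s j by (intro square_le_of_contraction[OF _ R[OF s j] b]) blast
        ultimately show "(R j (U s) *\<^sub>v b + S j (U s) *\<^sub>v G s j) \<bullet> (R j (U s) *\<^sub>v b + S j (U s) *\<^sub>v G s j)
            \<le> b \<bullet> b + G s j \<bullet> G s j"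
          using scalar_prod_self_nonneg[of "G s j"] by simp
      qed (use h s in blast)
      also have "\<dots> = 0"
        using G0 s by simp
      finally show ?thesis .
    qed
    from estimate[OF t integrable_0 this] show "?e t \<le> qform (P \<otimes>\<^sub>K POm) F"
      by simp
  next
    fix t
    assume t: "t \<in> J"
      and int: "\<forall>t\<in>J. (\<lambda>s. \<Sum>j<N. (G s j \<bullet> G s j) * ds j) integrable_on {0..t}"
      and h: "\<forall>t\<in>J. \<forall>j<N.
         pos_def (m_nonneg n (lam j (U t)))
           (1\<^sub>m (m_nonneg n (lam j (U t))) - (R j (U t))\<^sup>T * R j (U t)) \<and>
         pos_semidef (m_neg n (lam j (U t)))
           (1\<^sub>m (m_neg n (lam j (U t))) - (S j (U t))\<^sup>T * S j (U t)
             - ((R j (U t))\<^sup>T * S j (U t))\<^sup>T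
               * minv (1\<^sub>m (m_nonneg n (lam j (U t))) - (R j (U t))\<^sup>T * R j (U t))
               * ((R j (U t))\<^sup>T * S j (U t))) \<and>
         Sig j (U t) = sqrt_diag (abs_diag (Lam_neg n (lam j (U t))))"
    have "?e' s \<le> 2 * (\<Sum>j<N. (G s j \<bullet> G s j) * ds j)" if s: "s \<in> J" for s
    proof (rule bound[OF s])
      fix j and b :: "real vec"
      assume j: "j < N" and b: "b \<in> carrier_vec (m_nonneg n (lam j (U s)))"
      show "(R j (U s) *\<^sub>v b + S j (U s) *\<^sub>v G s j) \<bullet> (R j (U s) *\<^sub>v b + S j (U s) *\<^sub>v G s j)
          \<le> b \<bullet> b + G s j \<bullet> G s j"
        by (rule add_square_le_of_Schur[OF _ _ R[OF s j] S(1)[OF s j] b G[OF s j]])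
          (use h s j in blast)+
    qed (use h s in blast)
    moreover have "(\<lambda>s. 2 * (\<Sum>j<N. (G s j \<bullet> G s j) * ds j)) integrable_on {0..t}"
      using integrable_on_cmult_left[OF bspec[OF int t], of 2] by simp
    ultimately have "?e t \<le> qform (P \<otimes>\<^sub>K POm) F
        + integral {0..t} (\<lambda>s. 2 * (\<Sum>j<N. (G s j \<bullet> G s j) * ds j))"
      by (intro estimate[OF t])
    then show "?e t \<le> qform (P \<otimes>\<^sub>K POm) F
        + 2 * integral {0..t} (\<lambda>s. \<Sum>j<N. (G s j \<bullet> G s j) * ds j)"
      by simp
  qed
qed

end
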